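(* Let $\mathcal{O}$ be a one-$\mathbb{Z}$-counter system with $n$ states. Suppose a configuration $\beta$ is reachable from a configuration $\alpha$ in $\mathcal{O}$, where $\alpha$ has counter value $c_\alpha$ and $\beta$ has counter value $c_\beta$. Then $\mathcal{O}$ has a path from $\alpha$ to $\beta$ of length at most $56n^2+n\cdot(|c_\alpha|+|c_\beta|)$.
   Context: A one-$\mathbb{Z}$-counter system ($\mathbb{Z}$-OCS) $\mathcal{O}$ consists of a finite set $Q$ of states, a set $T_{>0}\subseteq Q\times\{-1,0,1\}\times Q$ of positive transitions, a set $T_{<0}\subseteq Q\times\{-1,0,1\}\times Q$ of negative transitions and a set $T_{=0}\subseteq Q\times\{-1,0,1\}\times Q$ of zero tests; $T=T_{>0}\cup T_{<0}\cup T_{=0}$. A configuration is a pair $(q,c)\in Q\times\mathbb{Z}$ (state $q$, counter value $c$). A transition $t=(p,d,q)$ can be fired in $(p,c)$ if $t\in T_{>0}$ and $c>0$, or $t\in T_{<0}$ and $c<0$, or $t\in T_{=0}$ and $c=0$; the result is $(q,c+d)$. A path is a sequence $(\gamma_1,t_1)\cdots(\gamma_m,t_m)$ such that, for some configuration $\gamma_{m+1}$, firing $t_i$ in $\gamma_i$ yields $\gamma_{i+1}$ for $i=1,\dots,m$; its source is $\gamma_1$, target $\gamma_{m+1}$, length $m$. $\beta$ is reachable from $\alpha$ if there is a path from $\alpha$ to $\beta$. *)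

theory Defs
  imports Main
begin

record 'q zocs =
  states :: "'q set"
  tpos   :: "('q \<times> int \<times> 'q) set"
  tneg   :: "('q \<times> int \<times> 'q) set"
  tzero  :: "('q \<times> int \<times> 'q) set"

definition trans_set :: "'q zocs \<Rightarrow> ('q \<times> int \<times> 'q) set" where
  "trans_set S = tpos S \<union> tneg S \<union> tzero S"

definition wf_zocs :: "'q zocs \<Rightarrow> bool" where
  "wf_zocs S \<longleftrightarrow> finite (states S) \<and>
     (\<forall>(p, d, q) \<in> trans_set S. p \<in> states S \<and> q \<in> states S \<and> d \<in> {-1, 0, 1})"

type_synonym 'q config = "'q \<times> int"

definition fireable :: "'q zocs \<Rightarrow> 'q config \<Rightarrow> ('q \<times> int \<times> 'q) \<Rightarrow> bool" where
  "fireable S \<gamma> t \<longleftrightarrow> fst t = fst \<gamma> \<and>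
     ((t \<in> tpos S \<and> snd \<gamma> > 0) \<or> (t \<in> tneg S \<and> snd \<gamma> < 0) \<or> (t \<in> tzero S \<and> snd \<gamma> = 0))"

definition fire :: "'q config \<Rightarrow> ('q \<times> int \<times> 'q) \<Rightarrow> 'q config" where
  "fire \<gamma> t = (snd (snd t), snd \<gamma> + fst (snd t))"

fun is_path :: "'q zocs \<Rightarrow> ('q config \<times> ('q \<times> int \<times> 'q)) list \<Rightarrow> 'q config \<Rightarrow> 'q config \<Rightarrow> bool" where
  "is_path S [] \<alpha> \<beta> \<longleftrightarrow> \<alpha> = \<beta>"
| "is_path S ((\<gamma>, t) # \<pi>) \<alpha> \<beta> \<longleftrightarrow>
     \<gamma> = \<alpha> \<and> fireable S \<gamma> t \<and> is_path S \<pi> (fire \<gamma> t) \<beta>"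

definition reachable :: "'q zocs \<Rightarrow> 'q config \<Rightarrow> 'q config \<Rightarrow> bool" where
  "reachable S \<alpha> \<beta> \<longleftrightarrow> (\<exists>\<pi>. is_path S \<pi> \<alpha> \<beta>)"

end

(* Only a bounded strip of counter values matters: a shortest path visits each configuration of a
   strip of height O(n) around c_alpha, c_beta and 0 at most once. A part of the path that leaves
   the strip upwards meets a positive cycle C on its way up and a negative cycle D on its way down,
   which may be taken from fixed families of disjoint cycles of total length at most n. Iterating C
   and D changes the counter by any multiple of g = gcd(eff C, eff D), so between C and D only the
   residue of the counter modulo g matters. Hence, if two high parts (or two positions of the same
   one) meet in the same state with the same residue, then they can be spliced into a shortcut.
   In a path of minimal weight this bounds the total length of all the walks between C and D by n
   times the effect of C (over all high parts using C) and by n times the effect of D (over all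
   those using D), and the number of high parts that use both C and D by g. Summing the numbers
   of iterations then costs at most O(|C| eff D) for each pair C, D, and O(n |C|), O(n |D|) for
   each cycle, which is O(n^2) in total. *)

theory Submission
  imports Defs Complex_Main
begin

section \<open>Walks, their effects, and the vertices at their positions\<close>

section \<open>Walks in weighted graphs\<close>

type_synonym 'q edge = "'q \<times> int \<times> 'q"

fun walk :: "'q edge set \<Rightarrow> 'q \<Rightarrow> 'q edge list \<Rightarrow> 'q \<Rightarrow> bool" where
  "walk E p [] q \<longleftrightarrow> p = q"
| "walk E p (e # es) q \<longleftrightarrow> e \<in> E \<and> fst e = p \<and> walk E (snd (snd e)) es q"

definition eff :: "'q edge list \<Rightarrow> int" where
  "eff es = (\<Sum>e\<leftarrow>es. fst (snd e))"

lemma eff_simps [simp]: "eff [] = 0" "eff (e # es) = fst (snd e) + eff es"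
  by (simp_all add: eff_def)

lemma eff_append [simp]: "eff (xs @ ys) = eff xs + eff ys"
  by (simp add: eff_def)

lemma eff_take_drop: "eff (take s es) + eff (drop s es) = eff es"
  by (metis append_take_drop_id eff_append)

lemma walk_append: "walk E p (xs @ ys) q \<longleftrightarrow> (\<exists>z. walk E p xs z \<and> walk E z ys q)"
  by (induction xs arbitrary: p) auto

lemma walk_set: "walk E p es q \<Longrightarrow> set es \<subseteq> E"
  by (induction es arbitrary: p) auto

fun vertex :: "'q \<Rightarrow> 'q edge list \<Rightarrow> nat \<Rightarrow> 'q" where
  "vertex p es 0 = p"
| "vertex p es (Suc s) = snd (snd (es ! s))"

lemma walk_take:
  "walk E p es q \<Longrightarrow> s \<le> length es \<Longrightarrow> walk E p (take s es) (vertex p es s)"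
proof (induction s)
  case (Suc s)
  have "walk E p (take s es) (vertex p es s)"
    using Suc by simp
  moreover have "walk E p (take s es @ (es ! s) # drop (Suc s) es) q"
    using Suc.prems by (simp add: id_take_nth_drop[symmetric])
  then obtain z where "walk E p (take s es) z" "es ! s \<in> E" "fst (es ! s) = z"
    by (auto simp: walk_append)
  ultimately show ?case
    using Suc.prems by (auto simp: take_Suc_conv_app_nth walk_append)
qed simp

lemma walk_target_unique: "walk E p es q \<Longrightarrow> walk E' p es q' \<Longrightarrow> q = q'"
  by (induction es arbitrary: p) auto

lemma walk_drop:
  assumes "walk E p es q" "s \<le> length es"
  shows "walk E (vertex p es s) (drop s es) q"
proof -
  obtain z where "walk E p (take s es) z" "walk E z (drop s es) q"
    using assms(1) walk_append[of E p "take s es" "drop s es" q] by auto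
  then show ?thesis
    using walk_target_unique walk_take[OF assms] by metis
qed

lemma vertex_length: "walk E p es q \<Longrightarrow> vertex p es (length es) = q"
  using walk_drop[of E p es q "length es"] by simp

definition graph_on :: "'q set \<Rightarrow> 'q edge set \<Rightarrow> bool" where
  "graph_on V E \<longleftrightarrow> finite V \<and> (\<forall>(p, d, q) \<in> E. p \<in> V \<and> q \<in> V \<and> \<bar>d\<bar> \<le> 1)"

lemma graph_onD:
  assumes "graph_on V E" "e \<in> E"
  shows "fst e \<in> V" "snd (snd e) \<in> V" "\<bar>fst (snd e)\<bar> \<le> 1"
  using assms by (cases e; auto simp: graph_on_def)+

lemma eff_le_length:
  assumes "graph_on V E" "set es \<subseteq> E"
  shows "\<bar>eff es\<bar> \<le> int (length es)"
  using assms(2)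
proof (induction es)
  case (Cons e es)
  moreover have "\<bar>fst (snd e)\<bar> \<le> 1"
    using Cons.prems assms(1) by (auto dest: graph_onD(3))
  ultimately show ?case by simp
qed simp

lemma vertex_in:
  assumes "graph_on V E" "walk E p es q" "p \<in> V" "s \<le> length es"
  shows "vertex p es s \<in> V"
proof (cases s)
  case (Suc t)
  then have "es ! t \<in> E"
    using assms(2,4) walk_set by fastforce
  then show ?thesis
    using graph_onD(2)[OF assms(1)] Suc by auto
qed (use assms in simp)

section \<open>Cycles of one sign, and maximal vertex-disjoint families of them\<close>

section \<open>Simple cycles and maximal disjoint families\<close>

abbreviation base :: "'q edge list \<Rightarrow> 'q" where
  "base c \<equiv> fst (hd c)"

definition simple_cycle :: "'q edge set \<Rightarrow> 'q edge list \<Rightarrow> bool" where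
  "simple_cycle E c \<longleftrightarrow> c \<noteq> [] \<and> walk E (base c) c (base c) \<and> distinct (map fst c)"

abbreviation verts :: "'q edge list \<Rightarrow> 'q set" where
  "verts c \<equiv> fst ` set c"

lemma verts_subset:
  assumes "graph_on V E" "set es \<subseteq> E"
  shows "verts es \<subseteq> V"
  using assms graph_onD(1) by fastforce

text \<open>Only sources of edges are compared, so the second occurrence of \<open>z\<close> still
  has an edge leaving it and \<open>zs\<close> is nonempty. Hence both \<open>ys\<close> and
  \<open>xs @ zs\<close> are strictly shorter than \<open>es\<close>, which drives the two
  inductions below.\<close>

lemma repeated_vertex_decomp:
  assumes "walk E p es q" "\<not> distinct (map fst es)"
  obtains xs ys zs z where "es = xs @ ys @ zs" "ys \<noteq> []" "zs \<noteq> []"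
    "walk E p xs z" "walk E z ys z" "walk E z zs q"
proof -
  obtain us vs ws z where "map fst es = us @ [z] @ vs @ [z] @ ws"
    using not_distinct_decomp[OF assms(2)] by blast
  then obtain xs y ys y' zs where d: "es = xs @ (y # ys) @ (y' # zs)" "fst y = z" "fst y' = z"
    by (auto simp: map_eq_append_conv append_eq_map_conv Cons_eq_map_conv)
  obtain z1 z2 where w: "walk E p xs z1" "walk E z1 (y # ys) z2" "walk E z2 (y' # zs) q"
    using assms(1) unfolding d(1) walk_append by blast
  then have "z1 = z" "z2 = z"
    using d by auto
  with w d show thesis
    by (intro that[of xs "y # ys" "y' # zs" z]) auto
qed

text \<open>Cutting at a repeated vertex splits a closed walk into two shorter closed walks whose
  effects add up, so one of them inherits the sign.\<close>

lemma closed_walk_simple_cycle: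
  assumes "walk E p es p" "r * eff es > 0"
  shows "\<exists>c. simple_cycle E c \<and> r * eff c > 0 \<and> set c \<subseteq> set es"
  using assms
proof (induction "length es" arbitrary: p es rule: less_induct)
  case less
  show ?case
  proof (cases "distinct (map fst es)")
    case True
    moreover have "es \<noteq> []" using less.prems by auto
    moreover have "base es = p" using less.prems \<open>es \<noteq> []\<close> by (cases es) auto
    ultimately show ?thesis
      using less.prems unfolding simple_cycle_def by blast
  next
    case False
    obtain xs ys zs z where d: "es = xs @ ys @ zs" "ys \<noteq> []" "zs \<noteq> []"
      "walk E p xs z" "walk E z ys z" "walk E z zs p"
      using repeated_vertex_decomp[OF less.prems(1) False] by metis
    have w: "walk E p (xs @ zs) p"
      using d by (auto simp: walk_append)
    have "r * eff ys > 0 \<or> r * eff (xs @ zs) > 0"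
      using less.prems(2) by (auto simp: d(1) algebra_simps)
    then show ?thesis
    proof
      assume "r * eff ys > 0"
      with less.hyps[of ys z] d show ?thesis by fastforce
    next
      assume "r * eff (xs @ zs) > 0"
      with less.hyps[of "xs @ zs" p] d w show ?thesis by fastforce
    qed
  qed
qed

text \<open>A walk this steep has more edges than there are vertices, so it contains a closed part.
  Either that part has the sign \<open>r\<close> and yields the cycle, or deleting it leaves a
  shorter walk that is at least as steep.\<close>

lemma steep_walk_simple_cycle:
  assumes "graph_on V E" "\<bar>r\<bar> = 1" "walk E p es q" "r * eff es > int (card V)"
  shows "\<exists>c. simple_cycle E c \<and> r * eff c > 0 \<and> set c \<subseteq> set es"
  using assms(3,4)
proof (induction "length es" arbitrary: es rule: less_induct)
  case less
  have sub: "set es \<subseteq> E" using walk_set less.prems by metis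
  have "int (card V) < int (length es)"
    using eff_le_length[OF assms(1) sub] less.prems(2) assms(2) by (auto simp: abs_if split: if_splits)
  moreover have "card (set (map fst es)) \<le> card V"
    using verts_subset[OF assms(1) sub] assms(1) by (auto simp: graph_on_def intro: card_mono)
  ultimately have nd: "\<not> distinct (map fst es)"
    using distinct_card[of "map fst es"] by auto
  obtain xs ys zs z where d: "es = xs @ ys @ zs" "ys \<noteq> []" "zs \<noteq> []"
    "walk E p xs z" "walk E z ys z" "walk E z zs q"
    using repeated_vertex_decomp[OF less.prems(1) nd] by metis
  show ?case
  proof (cases "r * eff ys > 0")
    case True
    then show ?thesis
      using closed_walk_simple_cycle[OF d(5)] d(1) by fastforce
  next
    case False
    have w: "walk E p (xs @ zs) q"
      using d by (auto simp: walk_append)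
    have "r * eff (xs @ zs) > int (card V)"
      using False less.prems(2) by (auto simp: d(1) algebra_simps)
    with less.hyps[of "xs @ zs"] d w show ?thesis by fastforce
  qed
qed

text \<open>The sign \<open>r = 1\<close> selects cycles that raise the counter,
  \<open>r = -1\<close> those that lower it. Disjointness is what bounds the total length of the
  family by the number of vertices.\<close>

definition cycle_packing :: "'q edge set \<Rightarrow> int \<Rightarrow> 'q edge list set \<Rightarrow> bool" where
  "cycle_packing E r F \<longleftrightarrow> finite F \<and> (\<forall>c\<in>F. simple_cycle E c \<and> r * eff c > 0) \<and>
     (\<forall>c\<in>F. \<forall>c'\<in>F. c \<noteq> c' \<longrightarrow> verts c \<inter> verts c' = {})"

lemma cycle_packing_length:
  assumes "graph_on V E" "cycle_packing E r F"
  shows "(\<Sum>c\<in>F. length c) \<le> card V"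
proof -
  have "length c = card (verts c)" if "c \<in> F" for c
    using that assms(2) distinct_card[of "map fst c"]
    by (auto simp: cycle_packing_def simple_cycle_def)
  then have "(\<Sum>c\<in>F. length c) = (\<Sum>c\<in>F. card (verts c))"
    by simp
  also have "\<dots> = card (\<Union>c\<in>F. verts c)"
    using assms(2) by (intro card_UN_disjoint[symmetric]) (auto simp: cycle_packing_def)
  also have "\<dots> \<le> card V"
  proof (rule card_mono)
    show "finite V" using assms(1) by (simp add: graph_on_def)
    have "set c \<subseteq> E" if "c \<in> F" for c
      using that assms(2) walk_set by (fastforce simp: cycle_packing_def simple_cycle_def)
    then show "(\<Union>c\<in>F. verts c) \<subseteq> V"
      using verts_subset[OF assms(1)] by blast
  qed
  finally show ?thesis .
qed

text \<open>Packings have at most \<open>card V\<close> members, so one of greatest cardinality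
  exists. A cycle of the right sign disjoint from all its members could be added to it.\<close>

lemma maximal_cycle_packing:
  assumes "graph_on V E"
  obtains F where "cycle_packing E r F"
    "\<And>c. simple_cycle E c \<Longrightarrow> r * eff c > 0 \<Longrightarrow> \<exists>c'\<in>F. verts c \<inter> verts c' \<noteq> {}"
proof -
  have bound: "card F \<le> card V" if "cycle_packing E r F" for F
  proof -
    have "card F = (\<Sum>c\<in>F. 1)" by simp
    also have "\<dots> \<le> (\<Sum>c\<in>F. length c)"
      using that by (intro sum_mono) (auto simp: cycle_packing_def simple_cycle_def Suc_le_eq)
    finally show ?thesis
      using cycle_packing_length[OF assms that] by simp
  qed
  have "cycle_packing E r {}" by (simp add: cycle_packing_def)
  moreover have "\<forall>F. cycle_packing E r F \<longrightarrow> card F < Suc (card V)"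
    using bound by (simp add: less_Suc_eq_le)
  ultimately have "\<exists>F. cycle_packing E r F \<and> (\<forall>F'. cycle_packing E r F' \<longrightarrow> card F' \<le> card F)"
    by (rule ex_has_greatest_nat)
  then obtain F where F: "cycle_packing E r F" "\<And>F'. cycle_packing E r F' \<Longrightarrow> card F' \<le> card F"
    by blast
  moreover have "\<exists>c'\<in>F. verts c \<inter> verts c' \<noteq> {}" if c: "simple_cycle E c" "r * eff c > 0" for c
  proof (rule ccontr)
    assume "\<not> ?thesis"
    then have new: "\<forall>c'\<in>F. verts c \<inter> verts c' = {}" by simp
    then have new': "\<forall>c'\<in>F. verts c' \<inter> verts c = {}" by (simp only: Int_commute)
    have "verts c \<noteq> {}" using c by (auto simp: simple_cycle_def)
    with new have "c \<notin> F" by (metis Int_absorb)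
    have "cycle_packing E r (insert c F)"
      using F(1) c new new' unfolding cycle_packing_def by (simp only: ball_simps finite_insert) simp
    then have "card (insert c F) \<le> card F" by (rule F(2))
    with \<open>c \<notin> F\<close> F(1) show False by (auto simp: cycle_packing_def)
  qed
  ultimately show thesis using that by metis
qed

section \<open>How often to iterate a cycle so that another one can cancel the surplus\<close>

section \<open>Arithmetic of pumping\<close>

text \<open>By Bezout the congruence for \<open>k\<close> is solvable, and its solutions form one
  residue class modulo \<open>b / gcd a b\<close>. The first solution with
  \<open>N \<le> k * a\<close> is therefore only \<open>b / gcd a b\<close> beyond
  \<open>N / a\<close>.\<close>

lemma pumping_number:
  fixes a b X N :: int
  assumes "a > 0" "b > 0" "gcd a b dvd X" "N \<ge> 0"
  obtains k where "k \<ge> 0" "N \<le> k * a" "b dvd X + k * a"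
    "real_of_int k \<le> N / a + b / gcd a b"
proof -
  define g where "g = gcd a b"
  have g: "g > 0" "g dvd a" "g dvd b" using assms by (auto simp: g_def)
  define b' where "b' = b div g"
  have b': "b = b' * g" using g by (simp add: b'_def)
  have "b' > 0" using assms(2) g(1) by (simp add: b' zero_less_mult_iff)
  obtain u v where uv: "u * a + v * b = g"
    using bezout_int[of a b] by (auto simp: g_def)
  obtain x where x: "X = g * x" using assms(3) by (auto simp: g_def)
  define k0 where "k0 = - x * u"
  have k0: "b dvd X + k0 * a"
  proof -
    have "X + k0 * a = x * (g - u * a)" by (simp add: x k0_def algebra_simps)
    also have "g - u * a = v * b" using uv by linarith
    finally show ?thesis by simp
  qed
  \<comment> \<open>\<open>k1\<close> is \<open>N / a\<close> rounded up. Moving from there to the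
    residue class of \<open>k0\<close> adds at most \<open>b' - 1\<close>, which leaves room for the
    1 lost in rounding.\<close>
  define k1 where "k1 = (N + a - 1) div a"
  define k where "k = k1 + (k0 - k1) mod b'"
  have mod: "0 \<le> (k0 - k1) mod b'" "(k0 - k1) mod b' \<le> b' - 1"
    using \<open>b' > 0\<close> pos_mod_bound[of b' "k0 - k1"] by auto
  have da: "k1 * a + (N + a - 1) mod a = N + a - 1" by (simp add: k1_def)
  have ma: "0 \<le> (N + a - 1) mod a" "(N + a - 1) mod a \<le> a - 1"
    using assms(1) pos_mod_bound[of a "N + a - 1"] by auto
  have N: "N \<le> k1 * a" "k1 * a \<le> N + a - 1" using da ma by auto
  have "k1 \<ge> 0" using assms by (simp add: k1_def pos_imp_zdiv_nonneg_iff)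
  show thesis
  proof
    show "k \<ge> 0" using mod \<open>k1 \<ge> 0\<close> by (simp add: k_def)
    have "k1 * a \<le> k * a" using mod assms(1) by (intro mult_right_mono) (auto simp: k_def)
    with N(1) show "N \<le> k * a" by (rule order_trans)
    have "b' dvd k0 - k"
      unfolding k_def diff_diff_eq[symmetric] by (rule dvd_minus_mod)
    then have "b' * g dvd (k0 - k) * a" using g by (intro mult_dvd_mono)
    then have "b dvd (k0 - k) * a" by (simp only: b'[symmetric])
    from dvd_diff[OF k0 this]
    show "b dvd X + k * a" by (simp add: algebra_simps)
    have "real_of_int (k1 * a) \<le> real_of_int (N + a)" using N(2) by (simp only: of_int_le_iff)
    then have "real_of_int k1 \<le> N / a + 1" using assms(1) by (simp add: field_simps)
    moreover have "real_of_int ((k0 - k1) mod b') \<le> real_of_int b' - 1"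
      using mod(2) by linarith
    moreover have "real_of_int b = real_of_int b' * real_of_int g"
      by (subst b') simp
    then have "real_of_int b' = b / gcd a b"
      using g(1) by (simp add: g_def[symmetric])
    ultimately show "real_of_int k \<le> N / a + b / gcd a b"
      unfolding k_def by simp
  qed
qed

section \<open>Discrete intermediate values: last and first visits to a level\<close>

section \<open>Sequences with bounded steps\<close>

text \<open>Climbing by at most 1 per step, \<open>f\<close> cannot pass \<open>l\<close> upwards
  without taking this value. After the last such visit it never goes below \<open>l\<close> again,
  since it would have to cross \<open>l\<close> once more.\<close>

lemma last_at_level:
  fixes f :: "nat \<Rightarrow> int"
  assumes "i \<le> m" "f i \<le> l" "l \<le> f m" "\<And>k. i \<le> k \<Longrightarrow> k < m \<Longrightarrow> f (Suc k) \<le> f k + 1"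
  shows "\<exists>j. i \<le> j \<and> j \<le> m \<and> f j = l \<and> (\<forall>k. j \<le> k \<and> k \<le> m \<longrightarrow> l \<le> f k)"
  using assms(1,3,4)
proof (induction m rule: dec_induct)
  case base
  then show ?case using assms(2) by (intro exI[of _ i]) auto
next
  case (step m)
  show ?case
  proof (cases "f (Suc m) = l")
    case True
    then show ?thesis using step.hyps by (intro exI[of _ "Suc m"]) auto
  next
    case False
    then have "l \<le> f m" using step.prems(1) step.prems(2)[of m] step.hyps by simp
    then obtain j where "i \<le> j" "j \<le> m" "f j = l" "\<forall>k. j \<le> k \<and> k \<le> m \<longrightarrow> l \<le> f k"
      using step.IH step.prems(2) by auto
    then show ?thesis
      using step.prems(1) by (intro exI[of _ j]) (auto simp: le_Suc_eq)
  qed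
qed

lemma first_at_level:
  fixes f :: "nat \<Rightarrow> int"
  assumes "i \<le> m" "l \<le> f i" "f m \<le> l" "\<And>k. i \<le> k \<Longrightarrow> k < m \<Longrightarrow> f k \<le> f (Suc k) + 1"
  shows "\<exists>j. i \<le> j \<and> j \<le> m \<and> f j = l \<and> (\<forall>k. i \<le> k \<and> k \<le> j \<longrightarrow> l \<le> f k)"
  using assms(1,2,4)
proof (induction i rule: inc_induct)
  case base
  then show ?case using assms(3) by (intro exI[of _ m]) auto
next
  case (step i)
  show ?case
  proof (cases "f i = l")
    case True
    then show ?thesis using step.hyps by (intro exI[of _ i]) auto
  next
    case False
    then have "l \<le> f (Suc i)" using step.prems(1) step.prems(2)[of i] step.hyps by simp
    then obtain j where "Suc i \<le> j" "j \<le> m" "f j = l" "\<forall>k. Suc i \<le> k \<and> k \<le> j \<longrightarrow> l \<le> f k"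
      using step.IH step.prems(2) by auto
    moreover have "l \<le> f k" if "i \<le> k" "k \<le> j" for k
      using that calculation(4) step.prems(1) by (cases "k = i") auto
    ultimately show ?thesis by (intro exI[of _ j]) auto
  qed
qed

section \<open>From walks at sufficient height to paths of the counter system\<close>

section \<open>Runs of bounded length\<close>

definition reach_len :: "'q zocs \<Rightarrow> 'q config \<Rightarrow> 'q config \<Rightarrow> nat \<Rightarrow> bool" where
  "reach_len S \<alpha> \<beta> N \<longleftrightarrow> (\<exists>\<pi>. is_path S \<pi> \<alpha> \<beta> \<and> length \<pi> = N)"

lemma is_path_append:
  "is_path S (\<pi> @ \<rho>) \<alpha> \<gamma> \<longleftrightarrow> (\<exists>\<beta>. is_path S \<pi> \<alpha> \<beta> \<and> is_path S \<rho> \<beta> \<gamma>)"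
proof (induction \<pi> arbitrary: \<alpha>)
  case (Cons x \<pi>)
  then show ?case by (cases x) (simp del: split_paired_Ex)
qed simp

lemma reach_len_refl: "reach_len S \<alpha> \<alpha> 0"
  by (simp add: reach_len_def)

lemma reach_len_trans: "reach_len S \<alpha> \<beta> M \<Longrightarrow> reach_len S \<beta> \<gamma> N \<Longrightarrow> reach_len S \<alpha> \<gamma> (M + N)"
  unfolding reach_len_def by (metis is_path_append length_append)

definition step :: "'q zocs \<Rightarrow> 'q config \<Rightarrow> 'q config \<Rightarrow> bool" where
  "step S \<alpha> \<beta> \<longleftrightarrow> (\<exists>t. fireable S \<alpha> t \<and> \<beta> = fire \<alpha> t)"

lemma step_reach_len: "step S \<alpha> \<beta> \<Longrightarrow> reach_len S \<alpha> \<beta> 1"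
  unfolding step_def reach_len_def
  by (elim exE conjE, rule_tac x = "[(\<alpha>, t)]" in exI) simp

text \<open>The side \<open>s = 1\<close> is the graph of the positive transitions. For \<open>s = -1\<close> it is the graph of
  the negative ones with negated weights, so that in both cases the weights act on the height
  \<open>s * c\<close> of the counter value \<open>c\<close>.\<close>

definition side :: "'q zocs \<Rightarrow> int \<Rightarrow> 'q edge set" where
  "side S s = {(p, d, q). (p, s * d, q) \<in> (if s = 1 then tpos S else tneg S)}"

lemma graph_on_side:
  assumes "wf_zocs S" "s \<in> {1, -1}"
  shows "graph_on (states S) (side S s)"
proof -
  have "p \<in> states S \<and> q \<in> states S \<and> \<bar>d\<bar> \<le> 1" if "(p, d, q) \<in> side S s" for p d q
  proof -
    have "(p, s * d, q) \<in> trans_set S"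
      using that by (auto simp: side_def trans_set_def split: if_splits)
    then have "p \<in> states S \<and> q \<in> states S \<and> s * d \<in> {-1, 0, 1}"
      using assms(1) unfolding wf_zocs_def by blast
    with assms(2) show ?thesis by auto
  qed
  then show ?thesis
    using assms(1) by (auto simp: graph_on_def wf_zocs_def)
qed

text \<open>An edge lowers the height by at most 1, so a start above the length of the walk keeps
  every firing height positive, and there exactly the transitions of this side are enabled.\<close>

lemma walk_reach_len:
  assumes "graph_on V (side S s)" "s \<in> {1, -1}"
    and "walk (side S s) p es q" "h > int (length es)"
  shows "reach_len S (p, s * h) (q, s * (h + eff es)) (length es)"
  using assms(3,4)
proof (induction es arbitrary: p h)
  case Nil
  then show ?case by (simp add: reach_len_refl)
next
  case (Cons e es)
  obtain d p' where e: "e = (p, d, p')" "(p, d, p') \<in> side S s" "walk (side S s) p' es q"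
    using Cons.prems by (cases e) auto
  have "\<bar>d\<bar> \<le> 1" using assms(1) e(2) by (auto simp: graph_on_def)
  then have "h + d > int (length es)" using Cons.prems by auto
  from Cons.IH[OF e(3) this] have "reach_len S (p', s * (h + d)) (q, s * (h + d + eff es)) (length es)" .
  moreover have "step S (p, s * h) (p', s * (h + d))"
  proof -
    have "fireable S (p, s * h) (p, s * d, p')"
      using e(2) Cons.prems(2) assms(2) by (auto simp: side_def fireable_def)
    moreover have "(p', s * (h + d)) = fire (p, s * h) (p, s * d, p')"
      by (simp add: fire_def distrib_left)
    ultimately show ?thesis unfolding step_def by metis
  qed
  from reach_len_trans[OF step_reach_len[OF this] calculation]
  show ?case by (simp add: e(1) add.assoc)
qed

lemma cycle_up_reach_len:
  assumes "graph_on V (side S s)" "s \<in> {1, -1}"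
    and "walk (side S s) p c p" "h > int (length c)" "eff c \<ge> 0"
  shows "reach_len S (p, s * h) (p, s * (h + int k * eff c)) (k * length c)"
proof (induction k)
  case 0
  then show ?case by (simp add: reach_len_refl)
next
  case (Suc k)
  have "h \<le> h + int k * eff c" using assms(5) by simp
  then have "h + int k * eff c > int (length c)" using assms(4) by linarith
  from reach_len_trans[OF Suc walk_reach_len[OF assms(1,2,3) this]]
  have "reach_len S (p, s * h) (p, s * (h + int k * eff c + eff c)) (k * length c + length c)" .
  moreover have "h + int k * eff c + eff c = h + int (Suc k) * eff c" by (simp add: distrib_right)
  moreover have "k * length c + length c = Suc k * length c" by simp
  ultimately show ?case by (simp only:)
qed

text \<open>The parameter \<open>h\<close> is the final height. Every iteration of a lowering cycle
  ends at \<open>h\<close> or above, so the height condition is needed only there; the induction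
  adds a new iteration in front.\<close>

lemma cycle_down_reach_len:
  assumes "graph_on V (side S s)" "s \<in> {1, -1}"
    and "walk (side S s) p c p" "h > int (length c)" "eff c \<le> 0"
  shows "reach_len S (p, s * (h - int k * eff c)) (p, s * h) (k * length c)"
proof (induction k)
  case 0
  then show ?case by (simp add: reach_len_refl)
next
  case (Suc k)
  have "int (Suc k) * eff c \<le> 0" using assms(5) by (intro mult_nonneg_nonpos) auto
  then have "h - int (Suc k) * eff c > int (length c)" using assms(4) by linarith
  from walk_reach_len[OF assms(1,2,3) this]
  have "reach_len S (p, s * (h - int (Suc k) * eff c)) (p, s * (h - int (Suc k) * eff c + eff c)) (length c)" .
  moreover have "h - int (Suc k) * eff c + eff c = h - int k * eff c" by (simp add: distrib_right)
  ultimately have "reach_len S (p, s * (h - int (Suc k) * eff c)) (p, s * (h - int k * eff c)) (length c)"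
    by (simp only:)
  from reach_len_trans[OF this Suc] show ?case by (simp only: mult_Suc)
qed

section \<open>Double counting the cost of jumps over the cycle families\<close>

section \<open>The total cost of the jumps on one side\<close>

text \<open>A walk with \<open>T\<close> edges from the base of a positive cycle \<open>c\<close> to the base of a negative
  cycle \<open>d\<close> gets lifted by iterating \<open>c\<close> before it, and the surplus is removed by iterating \<open>d\<close>
  after it. The summand \<open>2 * n\<close> pays for reaching the first base and leaving the second.\<close>

definition jump_cost :: "nat \<Rightarrow> 'q edge list \<Rightarrow> nat \<Rightarrow> 'q edge list \<Rightarrow> real" where
  "jump_cost n c T d =
     2 * real n + real T
     + real (length c) * ((real T + 4 * real n) / eff c - eff d / gcd (eff c) (eff d))
     + real (length d) * ((2 * real T + 8 * real n) / (- eff d) + eff c / gcd (eff c) (eff d))"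

lemma sum_fibres_le:
  fixes w K :: "_ \<Rightarrow> real"
  assumes "finite I" "finite F" "f ` I \<subseteq> F"
    and "\<And>c. c \<in> F \<Longrightarrow> (\<Sum>i\<in>{i\<in>I. f i = c}. w i) \<le> K c"
  shows "(\<Sum>i\<in>I. w i) \<le> (\<Sum>c\<in>F. K c)"
proof -
  have "(\<Sum>i\<in>I. w i) = (\<Sum>c\<in>F. \<Sum>i\<in>{i\<in>I. f i = c}. w i)"
    using sum.group[OF assms(1,2,3), of w] by simp
  also have "\<dots> \<le> (\<Sum>c\<in>F. K c)"
    by (intro sum_mono assms(4))
  finally show ?thesis .
qed

text \<open>Here \<open>e c\<close> is the absolute effect of the cycle \<open>c\<close> and
  \<open>l c\<close> its length. On the fibre of \<open>c\<close> the numerators sum to at most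
  \<open>5 * n * e c\<close>; dividing by \<open>e c\<close> leaves \<open>5 * n\<close> for each
  unit of length, and the lengths sum to at most \<open>n\<close>.\<close>

lemma sum_pump_up_le:
  fixes e :: "'c \<Rightarrow> real" and l :: "'c \<Rightarrow> nat" and T :: "'i \<Rightarrow> nat"
  assumes "finite I" "finite F" "f ` I \<subseteq> F" "(\<Sum>c\<in>F. l c) \<le> n"
    and "\<And>c. c \<in> F \<Longrightarrow> 0 < e c"
    and "\<And>c. c \<in> F \<Longrightarrow> (\<Sum>i\<in>{i\<in>I. f i = c}. real (T i)) \<le> n * e c"
    and "\<And>c. c \<in> F \<Longrightarrow> real (card {i\<in>I. f i = c}) \<le> e c"
  shows "(\<Sum>i\<in>I. real (l (f i)) * ((real (T i) + 4 * real n) / e (f i))) \<le> 5 * real n ^ 2"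
proof -
  have "(\<Sum>i\<in>I. real (l (f i)) * ((real (T i) + 4 * real n) / e (f i))) \<le> (\<Sum>c\<in>F. real (l c) * (5 * real n))"
  proof (rule sum_fibres_le[OF assms(1-3)])
    fix c assume c: "c \<in> F"
    have "(\<Sum>i\<in>{i\<in>I. f i = c}. real (T i) + 4 * real n)
        = (\<Sum>i\<in>{i\<in>I. f i = c}. real (T i)) + 4 * real n * real (card {i\<in>I. f i = c})"
      by (simp add: sum.distrib)
    also have "\<dots> \<le> n * e c + 4 * real n * e c"
      by (intro add_mono mult_left_mono assms(6,7) c) auto
    finally have *: "(\<Sum>i\<in>{i\<in>I. f i = c}. real (T i) + 4 * real n) \<le> n * e c + 4 * real n * e c" .
    have "(\<Sum>i\<in>{i\<in>I. f i = c}. real (l (f i)) * ((real (T i) + 4 * real n) / e (f i)))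
        = real (l c) / e c * (\<Sum>i\<in>{i\<in>I. f i = c}. real (T i) + 4 * real n)"
      by (simp add: sum_distrib_left)
    also have "\<dots> \<le> real (l c) / e c * (n * e c + 4 * real n * e c)"
      using assms(5)[OF c] by (intro mult_left_mono *) auto
    also have "\<dots> = real (l c) * (5 * real n)"
      using assms(5)[OF c] by (simp add: field_simps)
    finally show "(\<Sum>i\<in>{i\<in>I. f i = c}. real (l (f i)) * ((real (T i) + 4 * real n) / e (f i)))
        \<le> real (l c) * (5 * real n)" .
  qed
  also have "\<dots> = real (\<Sum>c\<in>F. l c) * (5 * real n)"
    by (simp add: sum_distrib_right)
  also have "\<dots> \<le> real n * (5 * real n)"
    using assms(4) by (intro mult_right_mono) (auto simp only: of_nat_le_iff of_nat_0_le_iff)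
  finally show ?thesis by (simp add: power2_eq_square)
qed

text \<open>A pair of cycles is used at most \<open>g (c, d)\<close> times, which cancels the
  denominator. What remains is the sum of \<open>l c * e d\<close> over all pairs, a product of two
  sums that are each at most \<open>n\<close>.\<close>

lemma sum_residue_le:
  fixes g e :: "_ \<Rightarrow> real" and l :: "_ \<Rightarrow> nat"
  assumes "finite I" "finite F" "finite G" "(\<lambda>i. (f i, h i)) ` I \<subseteq> F \<times> G"
    and "(\<Sum>c\<in>F. l c) \<le> n" "(\<Sum>d\<in>G. e d) \<le> n" "\<And>d. d \<in> G \<Longrightarrow> 0 \<le> e d"
    and "\<And>c d. c \<in> F \<Longrightarrow> d \<in> G \<Longrightarrow> 0 < g (c, d)"
    and "\<And>c d. c \<in> F \<Longrightarrow> d \<in> G \<Longrightarrow> real (card {i\<in>I. f i = c \<and> h i = d}) \<le> g (c, d)"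
  shows "(\<Sum>i\<in>I. real (l (f i)) * (e (h i) / g (f i, h i))) \<le> real n ^ 2"
proof -
  have "(\<Sum>i\<in>I. real (l (f i)) * (e (h i) / g (f i, h i))) \<le> (\<Sum>(c, d)\<in>F \<times> G. real (l c) * e d)"
  proof (rule sum_fibres_le[OF assms(1) _ assms(4)])
    show "finite (F \<times> G)" using assms by simp
    fix cd assume "cd \<in> F \<times> G"
    then obtain c d where cd: "cd = (c, d)" "c \<in> F" "d \<in> G" by auto
    have "(\<Sum>i\<in>{i\<in>I. (f i, h i) = cd}. real (l (f i)) * (e (h i) / g (f i, h i)))
       = real (card {i\<in>I. f i = c \<and> h i = d}) * (real (l c) * (e d / g (c, d)))"
      by (simp add: cd)
    also have "\<dots> \<le> g (c, d) * (real (l c) * (e d / g (c, d)))"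
      using assms(7,8,9) cd by (intro mult_right_mono) (auto simp: less_imp_le)
    also have "\<dots> = real (l c) * e d"
      using assms(8)[OF cd(2,3)] by simp
    finally show "(\<Sum>i\<in>{i\<in>I. (f i, h i) = cd}. real (l (f i)) * (e (h i) / g (f i, h i)))
        \<le> (case cd of (c, d) \<Rightarrow> real (l c) * e d)"
      by (simp add: cd)
  qed
  also have "\<dots> = (\<Sum>c\<in>F. real (l c)) * (\<Sum>d\<in>G. e d)"
    by (simp add: sum.cartesian_product sum_product)
  also have "\<dots> \<le> real n * real n"
    using assms(5,6,7) by (intro mult_mono sum_nonneg) (auto simp flip: of_nat_sum)
  finally show ?thesis by (simp add: power2_eq_square)
qed

text \<open>The constant is 2 + 1 + 5 + 10 + 1 + 1: at most \<open>n\<close> jumps pay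
  \<open>2 * n\<close> each, the walks have total length at most \<open>n\<close> squared, iterating
  up costs 5 and iterating down twice as much, and each of the two residue terms costs 1.\<close>

lemma sum_jump_cost_le:
  fixes C D :: "'i \<Rightarrow> 'q edge list" and T :: "'i \<Rightarrow> nat"
  assumes "finite I" "finite F" "finite G" "C ` I \<subseteq> F" "D ` I \<subseteq> G"
    and "(\<Sum>c\<in>F. length c) \<le> n" "(\<Sum>d\<in>G. length d) \<le> n"
    and F: "\<And>c. c \<in> F \<Longrightarrow> 0 < eff c" "\<And>c. c \<in> F \<Longrightarrow> eff c \<le> int (length c)"
    and G: "\<And>d. d \<in> G \<Longrightarrow> eff d < 0" "\<And>d. d \<in> G \<Longrightarrow> - eff d \<le> int (length d)"
    and "\<And>c. c \<in> F \<Longrightarrow> (\<Sum>i\<in>{i\<in>I. C i = c}. real (T i)) \<le> n * real_of_int (eff c)"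
    and "\<And>d. d \<in> G \<Longrightarrow> (\<Sum>i\<in>{i\<in>I. D i = d}. real (T i)) \<le> n * real_of_int (- eff d)"
    and "\<And>c. c \<in> F \<Longrightarrow> real (card {i\<in>I. C i = c}) \<le> real_of_int (eff c)"
    and "\<And>d. d \<in> G \<Longrightarrow> real (card {i\<in>I. D i = d}) \<le> real_of_int (- eff d)"
    and "\<And>c d. c \<in> F \<Longrightarrow> d \<in> G \<Longrightarrow>
          real (card {i\<in>I. C i = c \<and> D i = d}) \<le> real_of_int (gcd (eff c) (eff d))"
  shows "(\<Sum>i\<in>I. jump_cost n (C i) (T i) (D i)) \<le> 20 * real n ^ 2"
proof -
  define g :: "'q edge list \<times> 'q edge list \<Rightarrow> real" where "g = (\<lambda>(c, d). gcd (eff c) (eff d))"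
  have Fe: "(\<Sum>c\<in>F. real_of_int (eff c)) \<le> n"
  proof -
    have "(\<Sum>c\<in>F. real_of_int (eff c)) \<le> (\<Sum>c\<in>F. real (length c))"
      using F(2) by (intro sum_mono) (metis of_int_le_iff of_int_of_nat_eq)
    then show ?thesis using assms(6) by (simp flip: of_nat_sum)
  qed
  have Ge: "(\<Sum>d\<in>G. real_of_int (- eff d)) \<le> n"
  proof -
    have "(\<Sum>d\<in>G. real_of_int (- eff d)) \<le> (\<Sum>d\<in>G. real (length d))"
      using G(2) by (intro sum_mono) (metis of_int_le_iff of_int_of_nat_eq)
    then show ?thesis using assms(7) by (simp flip: of_nat_sum)
  qed
  have gpos: "0 < g (c, d)" if "c \<in> F" for c d
    using F(1)[OF that] by (simp add: g_def)
  have cardI: "real (card I) \<le> n"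
  proof -
    have "(\<Sum>i\<in>I. 1) \<le> (\<Sum>c\<in>F. real_of_int (eff c))"
      using assms(14) by (intro sum_fibres_le[OF assms(1,2,4)]) simp
    then show ?thesis using Fe by simp
  qed
  have sumT: "(\<Sum>i\<in>I. real (T i)) \<le> real n * real n"
  proof -
    have "(\<Sum>i\<in>I. real (T i)) \<le> (\<Sum>c\<in>F. n * real_of_int (eff c))"
      by (intro sum_fibres_le[OF assms(1,2,4)] assms(12))
    also have "\<dots> = real n * (\<Sum>c\<in>F. real_of_int (eff c))" by (simp add: sum_distrib_left)
    also have "\<dots> \<le> real n * real n" using Fe by (intro mult_left_mono) auto
    finally show ?thesis .
  qed
  have up: "(\<Sum>i\<in>I. real (length (C i)) * ((real (T i) + 4 * real n) / real_of_int (eff (C i)))) \<le> 5 * real n ^ 2"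
    using assms F(1) by (intro sum_pump_up_le[where F = F]) auto
  have down: "(\<Sum>i\<in>I. real (length (D i)) * ((real (T i) + 4 * real n) / real_of_int (- eff (D i)))) \<le> 5 * real n ^ 2"
    using assms G(1) by (intro sum_pump_up_le[where F = G and e = "\<lambda>d. real_of_int (- eff d)"]) auto
  have "(\<Sum>i\<in>I. real (length (C i)) * (real_of_int (- eff (D i)) / g (C i, D i))) \<le> real n ^ 2"
    using assms gpos Ge
    by (intro sum_residue_le[where F = F and G = G and e = "\<lambda>d. real_of_int (- eff d)"])
       (auto simp: g_def less_imp_le)
  moreover have "(\<Sum>i\<in>I. real (length (D i)) * (real_of_int (eff (C i)) / g (C i, D i))) \<le> real n ^ 2"
  proof -
    have "(\<Sum>i\<in>I. real (length (D i)) * (real_of_int (eff (C i)) / (\<lambda>(d, c). g (c, d)) (D i, C i))) \<le> real n ^ 2"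
      using assms gpos Fe
      by (intro sum_residue_le[where F = G and G = F and e = "\<lambda>d. real_of_int (eff d)"])
         (auto simp: g_def less_imp_le conj_commute)
    then show ?thesis by simp
  qed
  moreover have "jump_cost n (C i) (T i) (D i) = 2 * real n + real (T i)
      + real (length (C i)) * ((real (T i) + 4 * real n) / real_of_int (eff (C i)))
      + 2 * (real (length (D i)) * ((real (T i) + 4 * real n) / real_of_int (- eff (D i))))
      + real (length (C i)) * (real_of_int (- eff (D i)) / g (C i, D i))
      + real (length (D i)) * (real_of_int (eff (C i)) / g (C i, D i))" for i
    by (simp add: jump_cost_def g_def ring_distribs add_divide_distrib mult.left_commute)
  then have "(\<Sum>i\<in>I. jump_cost n (C i) (T i) (D i)) = 2 * real n * real (card I) + (\<Sum>i\<in>I. real (T i))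
      + (\<Sum>i\<in>I. real (length (C i)) * ((real (T i) + 4 * real n) / real_of_int (eff (C i))))
      + 2 * (\<Sum>i\<in>I. real (length (D i)) * ((real (T i) + 4 * real n) / real_of_int (- eff (D i))))
      + (\<Sum>i\<in>I. real (length (C i)) * (real_of_int (- eff (D i)) / g (C i, D i)))
      + (\<Sum>i\<in>I. real (length (D i)) * (real_of_int (eff (C i)) / g (C i, D i)))"
    by (simp only: sum.distrib sum_distrib_left sum_constant mult.commute)
  moreover have "2 * real n * real (card I) \<le> 2 * real n * real n"
    using cardI by (intro mult_left_mono) auto
  ultimately show ?thesis
    using up down sumT unfolding power2_eq_square by linarith
qed

section \<open>Counting residues along walks that admit no splicing\<close>

text \<open>In the last assumption, the prefix of the \<open>i\<close>-th walk and the suffix of the \<open>j\<close>-th walk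
  meet at a common vertex; the assumption says that they cannot be spliced into a shortcut. Hence
  the pairs of a vertex and a residue modulo the effect of a cycle \<open>c\<close> are never repeated along
  all the walks that start with \<open>c\<close>, nor those modulo the effect of \<open>d\<close> along the walks that end
  with \<open>d\<close>. For \<open>s = t = 0\<close>, the start residues of the walks from \<open>c\<close> to \<open>d\<close> are distinct
  even modulo the greatest common divisor.\<close>

locale unspliceable =
  fixes V :: "'q set" and E :: "'q edge set" and I :: "nat set"
    and C D W :: "nat \<Rightarrow> 'q edge list" and A B :: "nat \<Rightarrow> int"
  assumes graph: "graph_on V E" and fin: "finite I"
    and cycles: "\<And>i. i \<in> I \<Longrightarrow> simple_cycle E (C i)"
    and W: "\<And>i. i \<in> I \<Longrightarrow> walk E (base (C i)) (W i) (base (D i))"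
    and dvd: "\<And>i. i \<in> I \<Longrightarrow> gcd (eff (C i)) (eff (D i)) dvd A i + eff (W i) - B i"
    and unspliceable: "\<And>i j s t. i \<in> I \<Longrightarrow> j \<in> I \<Longrightarrow> i < j \<or> i = j \<and> s < t \<Longrightarrow>
      s \<le> length (W i) \<Longrightarrow> t \<le> length (W j) \<Longrightarrow>
      vertex (base (C i)) (W i) s = vertex (base (C j)) (W j) t \<Longrightarrow>
      \<not> gcd (eff (C i)) (eff (D j)) dvd A i + eff (take s (W i)) + eff (drop t (W j)) - B j"
begin

text \<open>\<open>P\<close> is the height at position \<open>s\<close> computed forwards from the
  entry height \<open>A i\<close>, \<open>Q\<close> the height there computed backwards from the
  exit height \<open>B i\<close>. For a jump the two need to agree only modulo the gcd of its
  cycles.\<close>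

definition P :: "nat \<Rightarrow> nat \<Rightarrow> int" where
  "P i s = A i + eff (take s (W i))"

definition Q :: "nat \<Rightarrow> nat \<Rightarrow> int" where
  "Q i s = B i - eff (drop s (W i))"

lemma P_Q_dvd: "i \<in> I \<Longrightarrow> gcd (eff (C i)) (eff (D i)) dvd P i s - Q i s"
  using dvd[of i] eff_take_drop[of s "W i"] by (simp add: P_def Q_def algebra_simps)

lemma not_dvd_P_Q:
  assumes "i \<in> I" "j \<in> I" "i < j \<or> i = j \<and> s < t" "s \<le> length (W i)" "t \<le> length (W j)"
    "vertex (base (C i)) (W i) s = vertex (base (C j)) (W j) t"
  shows "\<not> gcd (eff (C i)) (eff (D j)) dvd P i s - Q j t"
  using unspliceable[OF assms] by (simp add: P_def Q_def algebra_simps)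

text \<open>If the residues agreed, then \<open>P i s - Q j t\<close> would be the sum of
  \<open>P i s - P j t\<close> and \<open>P j t - Q j t\<close>, both divisible by the gcd for
  \<open>C i = C j\<close> and \<open>D j\<close>, so the walks could be spliced. The modulus is
  left open: it will be the effect of a cycle, or the gcd for a fixed pair of cycles.\<close>

lemma P_distinct:
  assumes "i \<in> I" "j \<in> I" "i < j \<or> i = j \<and> s < t" "s \<le> length (W i)" "t \<le> length (W j)"
    "vertex (base (C i)) (W i) s = vertex (base (C j)) (W j) t"
    and "C i = C j" "gcd (eff (C j)) (eff (D j)) dvd m"
  shows "P i s mod m \<noteq> P j t mod m"
proof
  assume "P i s mod m = P j t mod m"
  then have "m dvd P i s - P j t" by (simp add: mod_eq_dvd_iff)
  then have "gcd (eff (C j)) (eff (D j)) dvd (P i s - P j t) + (P j t - Q j t)"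
    using assms(8) P_Q_dvd[OF assms(2)] by (intro dvd_add) (auto intro: dvd_trans)
  then show False using not_dvd_P_Q[OF assms(1-6)] assms(7) by simp
qed

text \<open>The mirror image: the splice is compared through \<open>Q i s\<close>, and it is now the
  lowering cycle that the two walks share.\<close>

lemma Q_distinct:
  assumes "i \<in> I" "j \<in> I" "i < j \<or> i = j \<and> s < t" "s \<le> length (W i)" "t \<le> length (W j)"
    "vertex (base (C i)) (W i) s = vertex (base (C j)) (W j) t"
    and "D i = D j"
  shows "Q i s mod (- eff (D j)) \<noteq> Q j t mod (- eff (D j))"
proof
  assume "Q i s mod (- eff (D j)) = Q j t mod (- eff (D j))"
  then have "eff (D j) dvd Q i s - Q j t" by (simp add: mod_eq_dvd_iff)
  then have "gcd (eff (C i)) (eff (D j)) dvd (P i s - Q i s) + (Q i s - Q j t)"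
    using P_Q_dvd[OF assms(1), of s] assms(7) by (intro dvd_add) (auto intro: dvd_trans)
  then show False using not_dvd_P_Q[OF assms(1-6)] by simp
qed

abbreviation "positions J \<equiv> Sigma J (\<lambda>i. {..length (W i)})"

text \<open>Vertex and residue together embed the positions into \<open>V\<close> times the residues
  modulo \<open>m\<close>. A walk has one position more than it has edges, hence the summand
  1.\<close>

lemma card_positions_le:
  fixes R :: "nat \<Rightarrow> nat \<Rightarrow> int"
  assumes "J \<subseteq> I" "m > 0"
    and distinct: "\<And>i j s t. i \<in> J \<Longrightarrow> j \<in> J \<Longrightarrow> i < j \<or> i = j \<and> s < t \<Longrightarrow>
      s \<le> length (W i) \<Longrightarrow> t \<le> length (W j) \<Longrightarrow>
      vertex (base (C i)) (W i) s = vertex (base (C j)) (W j) t \<Longrightarrow> R i s mod m \<noteq> R j t mod m"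
  shows "(\<Sum>i\<in>J. real (length (W i)) + 1) \<le> real (card V) * real_of_int m"
proof -
  define \<phi> where "\<phi> = (\<lambda>(i, s). (vertex (base (C i)) (W i) s, R i s mod m))"
  have finJ: "finite J" using assms(1) fin finite_subset by blast
  have "inj_on \<phi> (positions J)"
  proof (rule inj_onI)
    fix x y assume xy: "x \<in> positions J" "y \<in> positions J" "\<phi> x = \<phi> y"
    obtain i s j t where [simp]: "x = (i, s)" "y = (j, t)" by (cases x; cases y)
    have "\<not> (i < j \<or> i = j \<and> s < t)"
      using distinct[of i j s t] xy by (auto simp: \<phi>_def)
    moreover have "\<not> (j < i \<or> j = i \<and> t < s)"
      using distinct[of j i t s] xy by (auto simp: \<phi>_def)
    ultimately show "x = y" by auto
  qed
  moreover have "\<phi> ` positions J \<subseteq> V \<times> {0..<m}"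
  proof -
    have "vertex (base (C i)) (W i) s \<in> V" if "i \<in> J" "s \<le> length (W i)" for i s
    proof (rule vertex_in[OF graph])
      have i: "i \<in> I" using that assms(1) by blast
      show "walk E (base (C i)) (W i) (base (D i))" by (rule W[OF i])
      have "hd (C i) \<in> E"
        using cycles[OF i] walk_set by (fastforce simp: simple_cycle_def)
      then show "base (C i) \<in> V" by (rule graph_onD(1)[OF graph])
    qed (use that in simp)
    then show ?thesis using assms(2) by (auto simp: \<phi>_def)
  qed
  ultimately have "card (positions J) \<le> card (V \<times> {0..<m})"
    using graph by (intro card_inj_on_le) (auto simp: graph_on_def)
  also have "card (V \<times> {0..<m}) = card V * nat m"
    by (simp add: card_cartesian_product)
  also have "card (positions J) = (\<Sum>i\<in>J. length (W i) + 1)"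
    using finJ by simp
  finally have "real (\<Sum>i\<in>J. length (W i) + 1) \<le> real (card V * nat m)"
    by (simp only: of_nat_le_iff)
  then show ?thesis using assms(2) by (simp add: add.commute)
qed

text \<open>This is applied to the starts of walks with a common first cycle, or to the ends of
  walks with a common last cycle. There the vertex is always the same base, so residues alone
  separate the walks and the factor \<open>card V\<close> disappears.\<close>

lemma card_starts_le:
  fixes R :: "nat \<Rightarrow> int"
  assumes "J \<subseteq> I" "m > 0"
    and distinct: "\<And>i j. i \<in> J \<Longrightarrow> j \<in> J \<Longrightarrow> i < j \<Longrightarrow> R i mod m \<noteq> R j mod m"
  shows "real (card J) \<le> real_of_int m"
proof -
  have "inj_on (\<lambda>i. R i mod m) J"
    by (rule linorder_inj_onI) (use distinct in auto)
  moreover have "(\<lambda>i. R i mod m) ` J \<subseteq> {0..<m}" using assms(2) by auto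
  ultimately have "card J \<le> card {0..<m}" by (intro card_inj_on_le) auto
  then show ?thesis using assms(2) by auto
qed

lemma sum_jump_cost_le_side:
  assumes F: "cycle_packing E 1 F" "C ` I \<subseteq> F" and G: "cycle_packing E (-1) G" "D ` I \<subseteq> G"
  shows "(\<Sum>i\<in>I. jump_cost (card V) (C i) (length (W i)) (D i)) \<le> 20 * real (card V) ^ 2"
proof (rule sum_jump_cost_le[where F = F and G = G])
  show Fpos: "0 < eff c" if "c \<in> F" for c using F that by (simp add: cycle_packing_def)
  show Gneg: "eff d < 0" if "d \<in> G" for d using G that by (simp add: cycle_packing_def)
  have "set c \<subseteq> E" if "c \<in> F \<union> G" for c
    using that F(1) G(1) walk_set by (fastforce simp: cycle_packing_def simple_cycle_def)
  then have "\<bar>eff c\<bar> \<le> int (length c)" if "c \<in> F \<union> G" for c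
    using that eff_le_length[OF graph] by blast
  then show "eff c \<le> int (length c)" if "c \<in> F" for c
    using that by (meson UnCI abs_le_D1)
  show "- eff d \<le> int (length d)" if "d \<in> G" for d
    using that \<open>\<And>c. c \<in> F \<union> G \<Longrightarrow> \<bar>eff c\<bar> \<le> int (length c)\<close> by (meson UnCI abs_le_D2)
  show "finite I" "C ` I \<subseteq> F" "D ` I \<subseteq> G" using fin F G by blast+
  show "finite F" "finite G" using F G by (auto simp: cycle_packing_def)
  show "(\<Sum>c\<in>F. length c) \<le> card V" "(\<Sum>d\<in>G. length d) \<le> card V"
    using cycle_packing_length[OF graph] F G by blast+
  show "(\<Sum>i\<in>{i\<in>I. C i = c}. real (length (W i))) \<le> card V * real_of_int (eff c)" if c: "c \<in> F" for c
  proof -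
    have "(\<Sum>i\<in>{i\<in>I. C i = c}. real (length (W i))) \<le> (\<Sum>i\<in>{i\<in>I. C i = c}. real (length (W i)) + 1)"
      by (intro sum_mono) simp
    also have "\<dots> \<le> card V * real_of_int (eff c)"
      by (intro card_positions_le[where R = P] P_distinct Fpos c) auto
    finally show ?thesis .
  qed
  show "(\<Sum>i\<in>{i\<in>I. D i = d}. real (length (W i))) \<le> card V * real_of_int (- eff d)" if d: "d \<in> G" for d
  proof -
    have "(\<Sum>i\<in>{i\<in>I. D i = d}. real (length (W i))) \<le> (\<Sum>i\<in>{i\<in>I. D i = d}. real (length (W i)) + 1)"
      by (intro sum_mono) simp
    also have "\<dots> \<le> card V * real_of_int (- eff d)"
    proof (intro card_positions_le[where R = Q])
      fix i j s t
      assume "i \<in> {i\<in>I. D i = d}" "j \<in> {i\<in>I. D i = d}" "i < j \<or> i = j \<and> s < t"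
        "s \<le> length (W i)" "t \<le> length (W j)"
        "vertex (base (C i)) (W i) s = vertex (base (C j)) (W j) t"
      then show "Q i s mod - eff d \<noteq> Q j t mod - eff d"
        using Q_distinct[of i j s t] by auto
    qed (use Gneg[OF d] in auto)
    finally show ?thesis .
  qed
  show "real (card {i\<in>I. C i = c}) \<le> real_of_int (eff c)" if "c \<in> F" for c
    using Fpos[OF that] P_distinct[of _ _ 0 0]
    by (intro card_starts_le[where R = "\<lambda>i. P i 0"]) auto
  show "real (card {i\<in>I. D i = d}) \<le> real_of_int (- eff d)" if "d \<in> G" for d
  proof (rule card_starts_le[where R = "\<lambda>i. Q i (length (W i))"])
    fix i j assume ij: "i \<in> {i\<in>I. D i = d}" "j \<in> {i\<in>I. D i = d}" "i < j"
    then have "vertex (base (C i)) (W i) (length (W i)) = vertex (base (C j)) (W j) (length (W j))"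
      using vertex_length[OF W] by auto
    with ij show "Q i (length (W i)) mod - eff d \<noteq> Q j (length (W j)) mod - eff d"
      using Q_distinct[of i j "length (W i)" "length (W j)"] by auto
  qed (use Gneg[OF that] in auto)
  show "real (card {i\<in>I. C i = c \<and> D i = d}) \<le> real_of_int (gcd (eff c) (eff d))"
    if "c \<in> F" "d \<in> G" for c d
  proof (rule card_starts_le[where R = "\<lambda>i. P i 0"])
    fix i j assume "i \<in> {i\<in>I. C i = c \<and> D i = d}" "j \<in> {i\<in>I. C i = c \<and> D i = d}" "i < j"
    then show "P i 0 mod gcd (eff c) (eff d) \<noteq> P j 0 mod gcd (eff c) (eff d)"
      using P_distinct[of i j 0 0 "gcd (eff c) (eff d)"] by auto
  qed (use Fpos[OF that(1)] in auto)
qed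

end

section \<open>Abstract jumps in place of the high parts of a path\<close>

section \<open>Plans\<close>

text \<open>A plan is a path in which each high part may be replaced by a jump. A jump remembers an
  uplifting cycle, a walk, and a lowering cycle; instead of the exact effect of the high part, it
  only records that the effects match modulo the greatest common divisor of the two cycles, so
  that they match exactly after suitable numbers of iterations of the cycles.\<close>

datatype 'q item =
    Step "'q config" "'q config"
  | is_Jump: Jump (sgn_of: int) "'q config" (up_of: "'q edge list") (A_of: int)
      (walk_of: "'q edge list") (B_of: int) (down_of: "'q edge list") "'q config"

fun src :: "'q item \<Rightarrow> 'q config" where
  "src (Step \<gamma> \<delta>) = \<gamma>"
| "src (Jump s \<gamma> c A w B d \<delta>) = \<gamma>"

fun tgt :: "'q item \<Rightarrow> 'q config" where
  "tgt (Step \<gamma> \<delta>) = \<delta>"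
| "tgt (Jump s \<gamma> c A w B d \<delta>) = \<delta>"

text \<open>Iterations of cycles are not counted: splicing controls the lengths of walks, while the
  iterations are charged afterwards through \<open>cost\<close>. The summand 1 makes the merging of
  two jumps a strict gain even when no edge is saved.\<close>

fun weight :: "'q item \<Rightarrow> nat" where
  "weight (Step \<gamma> \<delta>) = 1"
| "weight (Jump s \<gamma> c A w B d \<delta>) = length w + 1"

lemma weight_pos: "weight x > 0"
  by (cases x) auto

text \<open>For \<open>s = 1\<close> and \<open>s = -1\<close>, the heights between \<open>L s\<close> and \<open>L s + n + 1\<close> are those at which
  a jump on the side \<open>s\<close> may start or end.\<close>

locale low_zone =
  fixes S :: "'q zocs" and n :: nat and L :: "int \<Rightarrow> int" and F :: "int \<Rightarrow> int \<Rightarrow> 'q edge list set"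
  assumes wf: "wf_zocs S" and n: "n = card (states S)"
    and L: "s \<in> {1, -1} \<Longrightarrow> L s \<ge> 2 * int n + 1"
    and packing: "s \<in> {1, -1} \<Longrightarrow> r \<in> {1, -1} \<Longrightarrow> cycle_packing (side S s) r (F s r)"
    and maximal: "s \<in> {1, -1} \<Longrightarrow> r \<in> {1, -1} \<Longrightarrow> simple_cycle (side S s) c \<Longrightarrow> r * eff c > 0 \<Longrightarrow>
      \<exists>c'\<in>F s r. verts c \<inter> verts c' \<noteq> {}"
begin

lemmas graph = graph_on_side[OF wf]

definition low :: "'q config \<Rightarrow> bool" where
  "low \<gamma> \<longleftrightarrow> fst \<gamma> \<in> states S \<and> (\<forall>s\<in>{1, -1}. s * snd \<gamma> \<le> L s + int n + 1)"

definition border :: "int \<Rightarrow> 'q config \<Rightarrow> bool" where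
  "border s \<gamma> \<longleftrightarrow> fst \<gamma> \<in> states S \<and> L s \<le> s * snd \<gamma> \<and> s * snd \<gamma> \<le> L s + int n + 1"

text \<open>The walk to the base of \<open>c\<close> is hidden behind the quantifier; only its bound
  \<open>n\<close> and the height \<open>A\<close> on arrival are kept. Thus the entry of one jump
  can be combined freely with the exit of another.\<close>

definition enter :: "int \<Rightarrow> 'q config \<Rightarrow> 'q edge list \<Rightarrow> int \<Rightarrow> bool" where
  "enter s \<gamma> c A \<longleftrightarrow> border s \<gamma> \<and>
     (\<exists>p. walk (side S s) (fst \<gamma>) p (base c) \<and> length p \<le> n \<and> A = s * snd \<gamma> + eff p)"

definition leave :: "int \<Rightarrow> int \<Rightarrow> 'q edge list \<Rightarrow> 'q config \<Rightarrow> bool" where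
  "leave s B d \<delta> \<longleftrightarrow> border s \<delta> \<and>
     (\<exists>p. walk (side S s) (base d) p (fst \<delta>) \<and> length p \<le> n \<and> s * snd \<delta> = B + eff p)"

fun valid :: "'q item \<Rightarrow> bool" where
  "valid (Step \<gamma> \<delta>) \<longleftrightarrow> low \<gamma> \<and> low \<delta> \<and> step S \<gamma> \<delta>"
| "valid (Jump s \<gamma> c A w B d \<delta>) \<longleftrightarrow> s \<in> {1, -1} \<and> enter s \<gamma> c A \<and> leave s B d \<delta> \<and>
     c \<in> F s 1 \<and> d \<in> F s (-1) \<and> walk (side S s) (base c) w (base d) \<and>
     gcd (eff c) (eff d) dvd A + eff w - B"

fun cost :: "'q item \<Rightarrow> real" where
  "cost (Step \<gamma> \<delta>) = 1"
| "cost (Jump s \<gamma> c A w B d \<delta>) = jump_cost n c (length w) d"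

fun plan :: "'q config \<Rightarrow> 'q item list \<Rightarrow> 'q config \<Rightarrow> bool" where
  "plan \<alpha> [] \<beta> \<longleftrightarrow> \<alpha> = \<beta>"
| "plan \<alpha> (x # xs) \<beta> \<longleftrightarrow> valid x \<and> src x = \<alpha> \<and> plan (tgt x) xs \<beta>"

lemma plan_append: "plan \<alpha> (xs @ ys) \<gamma> \<longleftrightarrow> (\<exists>\<beta>. plan \<alpha> xs \<beta> \<and> plan \<beta> ys \<gamma>)"
  by (induction xs arbitrary: \<alpha>) auto

lemma plan_valid: "plan \<alpha> xs \<beta> \<Longrightarrow> x \<in> set xs \<Longrightarrow> valid x"
proof (induction xs arbitrary: \<alpha>)
  case (Cons y xs)
  then show ?case by (metis plan.simps(2) set_ConsD)
qed simp

lemma border_low: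
  assumes "s \<in> {1, -1}" "border s \<gamma>"
  shows "low \<gamma>"
proof -
  have "- s * snd \<gamma> \<le> L (- s) + int n + 1"
    using assms L[of s] L[of "- s"] by (auto simp: border_def)
  then show ?thesis using assms by (auto simp: low_def border_def)
qed

lemma valid_src_low: "valid x \<Longrightarrow> low (src x)"
  by (cases x) (auto simp: enter_def intro: border_low)

lemma cycle_facts:
  assumes "s \<in> {1, -1}" "r \<in> {1, -1}" "c \<in> F s r"
  shows "simple_cycle (side S s) c" "r * eff c > 0" "length c \<le> n"
proof -
  note p = packing[OF assms(1,2)]
  show "simple_cycle (side S s) c" "r * eff c > 0" using p assms(3) by (auto simp: cycle_packing_def)
  have "length c \<le> (\<Sum>c\<in>F s r. length c)"
    using p assms(3) by (intro member_le_sum) (auto simp: cycle_packing_def)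
  also have "\<dots> \<le> n" using cycle_packing_length[OF graph[OF assms(1)] p] by (simp add: n)
  finally show "length c \<le> n" .
qed

section \<open>From a plan to a path whose length is bounded by the cost\<close>

subsection \<open>Realising plans by paths\<close>

text \<open>The path goes to the base of \<open>c\<close>, iterates \<open>c\<close> for
  \<open>k\<close> rounds, follows \<open>w\<close>, iterates \<open>d\<close> for \<open>l\<close>
  rounds and goes on to the target. The divisibility condition allows \<open>k\<close> to be chosen
  so that the surplus over \<open>B\<close> is a multiple of the effect of \<open>d\<close>;
  \<open>l\<close> is the quotient.\<close>

lemma jump_reach_len:
  assumes "valid (Jump s \<gamma> c A w B d \<delta>)"
  shows "\<exists>N. reach_len S \<gamma> \<delta> N \<and> real N \<le> jump_cost n c (length w) d"
proof -
  define a b T where "a = eff c" and "b = - eff d" and "T = int (length w)"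
  define h h' where "h = s * snd \<gamma>" and "h' = s * snd \<delta>"
  have s: "s \<in> {1, -1}" and cF: "c \<in> F s 1" and dF: "d \<in> F s (-1)"
    and w: "walk (side S s) (base c) w (base d)" and dvd: "gcd (eff c) (eff d) dvd A + eff w - B"
    using assms by auto
  obtain p where p: "walk (side S s) (fst \<gamma>) p (base c)" "length p \<le> n" "A = h + eff p"
    and h: "L s \<le> h" "h \<le> L s + int n + 1" and \<gamma>: "fst \<gamma> \<in> states S"
    using assms by (auto simp: enter_def border_def h_def)
  obtain q where q: "walk (side S s) (base d) q (fst \<delta>)" "length q \<le> n" "h' = B + eff q"
    and h': "L s \<le> h'" "h' \<le> L s + int n + 1"
    using assms by (auto simp: leave_def border_def h'_def)
  have eq: "\<gamma> = (fst \<gamma>, s * h)" "\<delta> = (fst \<delta>, s * h')"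
    using s by (auto simp: h_def h'_def prod_eq_iff)
  have c: "simple_cycle (side S s) c" "a > 0" "length c \<le> n"
    using cycle_facts[OF s _ cF] by (auto simp: a_def)
  have d: "simple_cycle (side S s) d" "b > 0" "length d \<le> n"
    using cycle_facts[OF s _ dF] by (auto simp: b_def)
  have "n \<ge> 1"
    using \<gamma> n wf card_gt_0_iff[of "states S"] by (auto simp: wf_zocs_def)
  note abs = eff_le_length[OF graph[OF s] walk_set]
  have ep: "\<bar>eff p\<bar> \<le> int n" and eq': "\<bar>eff q\<bar> \<le> int n" and ew: "\<bar>eff w\<bar> \<le> T"
    using abs[OF p(1)] abs[OF q(1)] abs[OF w] p(2) q(2) by (auto simp: T_def)
  \<comment> \<open>Border heights are at least \<open>2 * n + 1\<close> and the short walks change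
    them by at most \<open>n\<close>, so the bases are reached above the length of either cycle. The
    two border heights differ by at most \<open>n + 1\<close>; with the two short walks this gives
    \<open>3 * n + 1\<close>, at most \<open>4 * n\<close> because \<open>n \<ge> 1\<close>.\<close>
  have A: "A \<ge> int n + 1" and B: "B \<ge> int n + 1" and AB: "\<bar>A - B\<bar> \<le> 4 * int n"
    using ep eq' h h' p(3) q(3) L[OF s] \<open>n \<ge> 1\<close> by linarith+
  \<comment> \<open>The lift by \<open>T + 4 * n\<close> serves two purposes: \<open>w\<close>
    starts high enough to stay positive, and the surplus over \<open>B\<close> after
    \<open>w\<close> is nonnegative, so that \<open>l\<close> is a number of iterations.\<close>
  obtain k where k: "k \<ge> 0" "T + 4 * int n \<le> k * a" "b dvd A + eff w - B + k * a"
      "real_of_int k \<le> real_of_int (T + 4 * int n) / a + b / gcd a b"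
    by (rule pumping_number[OF c(2) d(2), of "A + eff w - B" "T + 4 * int n"])
       (use dvd in \<open>auto simp: a_def b_def T_def\<close>)
  obtain l where l: "A + eff w - B + k * a = b * l" using k(3) by (rule dvdE)
  have "b * l \<ge> 0" using k(2) AB ew unfolding l[symmetric] by linarith
  then have l0: "l \<ge> 0" using d(2) by (simp add: zero_le_mult_iff)
  have "reach_len S \<gamma> (base c, s * A) (length p)"
    using walk_reach_len[OF graph[OF s] s p(1), of h] h L[OF s] p(2,3) eq(1) by simp
  moreover have "reach_len S (base c, s * A) (base c, s * (A + k * a)) (nat k * length c)"
    using cycle_up_reach_len[OF graph[OF s] s, of "base c" c A "nat k"] c A k(1)
    by (simp add: simple_cycle_def a_def)
  moreover have "reach_len S (base c, s * (A + k * a)) (base d, s * (A + k * a + eff w)) (length w)"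
    using k(2) A by (intro walk_reach_len[OF graph[OF s] s w]) (auto simp: T_def)
  moreover have "reach_len S (base d, s * (A + k * a + eff w)) (base d, s * B) (nat l * length d)"
  proof -
    have "B - int (nat l) * eff d = A + k * a + eff w"
      using l l0 by (simp add: b_def algebra_simps)
    then show ?thesis
      using cycle_down_reach_len[OF graph[OF s] s, of "base d" d B "nat l"] d B
      by (simp add: simple_cycle_def b_def)
  qed
  moreover have "reach_len S (base d, s * B) \<delta> (length q)"
    using walk_reach_len[OF graph[OF s] s q(1), of B] B q(2,3) eq(2) by simp
  ultimately have reach: "reach_len S \<gamma> \<delta>
      (length p + (nat k * length c + (length w + (nat l * length d + length q))))"
    by (blast intro: reach_len_trans)
  have g: "gcd a b = gcd (eff c) (eff d)" "gcd a b > 0"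
    using c(2) by (auto simp: a_def b_def)
  have kr: "real_of_int k \<le> (real (length w) + 4 * real n) / eff c - eff d / gcd (eff c) (eff d)"
    using k(4) by (simp add: a_def b_def T_def)
  have lr: "real_of_int l \<le> (2 * real (length w) + 8 * real n) / (- eff d) + eff c / gcd (eff c) (eff d)"
  proof -
    \<comment> \<open>The surplus contains the lift \<open>k * a\<close>, which is itself bounded
      through \<open>T + 4 * n\<close>. This is why \<open>T\<close> and \<open>4 * n\<close> are
      doubled in the count for the lowering cycle.\<close>
    have "b * l \<le> 4 * int n + T + k * a"
      using AB ew unfolding l[symmetric] by linarith
    then have "real_of_int (b * l) \<le> real_of_int (4 * int n + T + k * a)"
      by (simp only: of_int_le_iff)
    moreover have "real_of_int k * a \<le> (real_of_int (T + 4 * int n) / a + b / gcd a b) * a"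
      using k(4) c(2) by (intro mult_right_mono) auto
    moreover have "\<dots> = real_of_int (T + 4 * int n) + b * (a / gcd a b)"
      using c(2) by (simp add: field_simps)
    ultimately have "real_of_int b * l \<le> (2 * T + 8 * int n) + b * (a / gcd a b)"
      by simp
    also have "\<dots> = real_of_int b * ((2 * T + 8 * int n) / b + a / gcd a b)"
      using d(2) by (simp add: field_simps)
    finally have "real_of_int l \<le> (2 * T + 8 * int n) / b + a / gcd a b"
      using d(2) by (simp only: mult_le_cancel_left_pos of_int_0_less_iff)
    then show ?thesis
      unfolding g(1) by (simp add: a_def b_def T_def)
  qed
  have "real (length p + (nat k * length c + (length w + (nat l * length d + length q))))
      = real (length p) + real (length q) + real (length w)
        + real (length c) * real_of_int k + real (length d) * real_of_int l"
    using k(1) l0 by simp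
  also have "\<dots> \<le> jump_cost n c (length w) d"
    unfolding jump_cost_def
    using p(2) q(2) mult_left_mono[OF kr, of "real (length c)"] mult_left_mono[OF lr, of "real (length d)"]
    by simp
  finally show ?thesis using reach by blast
qed

lemma valid_reach_len:
  assumes "valid x"
  shows "\<exists>N. reach_len S (src x) (tgt x) N \<and> real N \<le> cost x"
proof (cases x)
  case (Step \<gamma> \<delta>)
  then show ?thesis using assms step_reach_len by fastforce
next
  case (Jump s \<gamma> c A w B d \<delta>)
  then show ?thesis using assms jump_reach_len by simp
qed

lemma plan_reach_len:
  assumes "plan \<alpha> xs \<beta>"
  shows "\<exists>N. reach_len S \<alpha> \<beta> N \<and> real N \<le> (\<Sum>x\<leftarrow>xs. cost x)"
  using assms
proof (induction xs arbitrary: \<alpha>)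
  case Nil
  then show ?case using reach_len_refl by fastforce
next
  case (Cons x xs)
  obtain M where M: "reach_len S \<alpha> (tgt x) M" "real M \<le> cost x"
    using Cons.prems valid_reach_len by fastforce
  obtain N where N: "reach_len S (tgt x) \<beta> N" "real N \<le> (\<Sum>x\<leftarrow>xs. cost x)"
    using Cons by fastforce
  show ?case
    using reach_len_trans[OF M(1) N(1)] M(2) N(2) by (intro exI[of _ "M + N"]) simp
qed

section \<open>Exchange arguments for plans of minimal weight\<close>

subsection \<open>Plans of minimal weight\<close>

definition minimal_plan :: "'q config \<Rightarrow> 'q item list \<Rightarrow> 'q config \<Rightarrow> bool" where
  "minimal_plan \<alpha> xs \<beta> \<longleftrightarrow> plan \<alpha> xs \<beta> \<and>
     (\<forall>ys. plan \<alpha> ys \<beta> \<longrightarrow> sum_list (map weight xs) \<le> sum_list (map weight ys))"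

lemma minimal_plan_weight:
  "minimal_plan \<alpha> xs \<beta> \<Longrightarrow> plan \<alpha> ys \<beta> \<Longrightarrow> sum_list (map weight xs) \<le> sum_list (map weight ys)"
  unfolding minimal_plan_def by blast

lemma minimal_plan_exists: "plan \<alpha> xs \<beta> \<Longrightarrow> \<exists>xs. minimal_plan \<alpha> xs \<beta>"
  unfolding minimal_plan_def
  using ex_has_least_nat[of "\<lambda>xs. plan \<alpha> xs \<beta>" xs "\<lambda>xs. sum_list (map weight xs)"] by simp

lemma split_two:
  assumes "i < j" "j < length xs"
  obtains us vs ws where "xs = us @ xs ! i # vs @ xs ! j # ws"
proof -
  have "xs = take i xs @ xs ! i # drop (Suc i) xs"
    using assms by (intro id_take_nth_drop) simp
  moreover have "drop (Suc i) xs = take (j - Suc i) (drop (Suc i) xs) @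
      drop (Suc i) xs ! (j - Suc i) # drop (Suc (j - Suc i)) (drop (Suc i) xs)"
    using assms by (intro id_take_nth_drop) simp
  moreover have "drop (Suc i) xs ! (j - Suc i) = xs ! j"
    using assms by simp
  ultimately show thesis using that by metis
qed

context
  fixes \<alpha> \<beta> xs
  assumes min: "minimal_plan \<alpha> xs \<beta>"
begin

lemma minimal_valid: "i < length xs \<Longrightarrow> valid (xs ! i)"
  using min plan_valid unfolding minimal_plan_def by (meson nth_mem)

lemma minimal_src_distinct:
  assumes "i < j" "j < length xs"
  shows "src (xs ! i) \<noteq> src (xs ! j)"
proof
  assume eq: "src (xs ! i) = src (xs ! j)"
  obtain us vs ws where xs: "xs = us @ xs ! i # vs @ xs ! j # ws"
    using split_two[OF assms] .
  have "plan \<alpha> (us @ xs ! i # vs @ xs ! j # ws) \<beta>"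
    using min xs by (simp add: minimal_plan_def)
  then have "plan \<alpha> (us @ xs ! j # ws) \<beta>"
    using eq by (auto simp: plan_append)
  then have "sum_list (map weight xs) \<le> sum_list (map weight (us @ xs ! j # ws))"
    by (rule minimal_plan_weight[OF min])
  moreover have "sum_list (map weight xs) = sum_list (map weight (us @ xs ! i # vs @ xs ! j # ws))"
    using xs by simp
  ultimately show False using weight_pos[of "xs ! i"] by simp
qed

lemma minimal_no_shortcut:
  assumes "i < j" "j < length xs" "valid x" "src x = src (xs ! i)" "tgt x = tgt (xs ! j)"
  shows "weight (xs ! i) + weight (xs ! j) \<le> weight x"
proof -
  obtain us vs ws where xs: "xs = us @ xs ! i # vs @ xs ! j # ws"
    using split_two[OF assms(1,2)] .
  have "plan \<alpha> (us @ xs ! i # vs @ xs ! j # ws) \<beta>"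
    using min xs by (simp add: minimal_plan_def)
  then have "plan \<alpha> (us @ x # ws) \<beta>"
    using assms(3-5) by (auto simp: plan_append)
  then have "sum_list (map weight xs) \<le> sum_list (map weight (us @ x # ws))"
    by (rule minimal_plan_weight[OF min])
  moreover have "sum_list (map weight xs) = sum_list (map weight (us @ xs ! i # vs @ xs ! j # ws))"
    using xs by simp
  ultimately show ?thesis by simp
qed

lemma minimal_no_lighter:
  assumes "i < length xs" "valid x" "src x = src (xs ! i)" "tgt x = tgt (xs ! i)"
  shows "weight (xs ! i) \<le> weight x"
proof -
  have xs: "xs = take i xs @ xs ! i # drop (Suc i) xs"
    using assms(1) by (rule id_take_nth_drop)
  have "plan \<alpha> (take i xs @ xs ! i # drop (Suc i) xs) \<beta>"
    using min xs by (simp add: minimal_plan_def)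
  then have "plan \<alpha> (take i xs @ x # drop (Suc i) xs) \<beta>"
    using assms(2-4) by (auto simp: plan_append)
  then have "sum_list (map weight xs) \<le> sum_list (map weight (take i xs @ x # drop (Suc i) xs))"
    by (rule minimal_plan_weight[OF min])
  moreover have "sum_list (map weight xs) = sum_list (map weight (take i xs @ xs ! i # drop (Suc i) xs))"
    using xs by simp
  ultimately show ?thesis by simp
qed

text \<open>Jumps too start at low configurations, so all sources lie in the strip. No configuration
  is the source of two items, since the part between them could be cut out.\<close>

lemma minimal_length: "real (length xs) \<le> real n * real_of_int (L 1 + L (-1) + 2 * int n + 3)"
proof -
  let ?Z = "states S \<times> {- (L (-1) + int n + 1) .. L 1 + int n + 1}"
  have "inj_on (\<lambda>i. src (xs ! i)) {..<length xs}"
    by (rule linorder_inj_onI) (use minimal_src_distinct in auto)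
  moreover have "src (xs ! i) \<in> ?Z" if "i < length xs" for i
    using valid_src_low[OF minimal_valid[OF that]] by (cases "src (xs ! i)") (auto simp: low_def)
  moreover have "finite ?Z" using wf by (simp add: wf_zocs_def)
  ultimately have "card {..<length xs} \<le> card ?Z"
    by (intro card_inj_on_le[where f = "\<lambda>i. src (xs ! i)"] image_subsetI) (simp_all only: lessThan_iff)
  then have "length xs \<le> n * nat (L 1 + L (-1) + 2 * int n + 3)"
    by (simp add: card_cartesian_product n algebra_simps)
  then have "real (length xs) \<le> real (n * nat (L 1 + L (-1) + 2 * int n + 3))"
    by (simp only: of_nat_le_iff)
  then show ?thesis using L[of 1] L[of "-1"] by simp
qed

definition jumps :: "int \<Rightarrow> nat set" where
  "jumps s = {i. i < length xs \<and> is_Jump (xs ! i) \<and> sgn_of (xs ! i) = s}"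

lemma jump_eq:
  assumes "i \<in> jumps s"
  shows "xs ! i = Jump s (src (xs ! i)) (up_of (xs ! i)) (A_of (xs ! i)) (walk_of (xs ! i))
    (B_of (xs ! i)) (down_of (xs ! i)) (tgt (xs ! i))"
  using assms by (cases "xs ! i") (auto simp: jumps_def)

lemma jump_valid:
  assumes "i \<in> jumps s"
  shows "valid (Jump s (src (xs ! i)) (up_of (xs ! i)) (A_of (xs ! i)) (walk_of (xs ! i))
    (B_of (xs ! i)) (down_of (xs ! i)) (tgt (xs ! i)))"
  using assms minimal_valid[of i] jump_eq[OF assms] by (simp add: jumps_def)

lemma jump_weight: "i \<in> jumps s \<Longrightarrow> weight (xs ! i) = length (walk_of (xs ! i)) + 1"
  by (cases "xs ! i") (auto simp: jumps_def)

text \<open>The forbidden divisibility is just what makes the spliced item \<open>?x\<close> valid,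
  entering like item \<open>i\<close> and leaving like item \<open>j\<close>. Replacing items
  \<open>i\<close> to \<open>j\<close> by it would save an item if \<open>i < j\<close>, and edges
  of the walk if \<open>i = j\<close> and \<open>u < t\<close>.\<close>

lemma unspliceable_jumps:
  assumes s: "s \<in> {1, -1}"
  shows "unspliceable (states S) (side S s) (jumps s) (\<lambda>i. up_of (xs ! i)) (\<lambda>i. down_of (xs ! i))
    (\<lambda>i. walk_of (xs ! i)) (\<lambda>i. A_of (xs ! i)) (\<lambda>i. B_of (xs ! i))"
proof
  show "graph_on (states S) (side S s)" by (rule graph[OF s])
  show "finite (jumps s)" by (simp add: jumps_def)
  fix i assume i: "i \<in> jumps s"
  note vi = jump_valid[OF i]
  show "simple_cycle (side S s) (up_of (xs ! i))"
    using vi cycle_facts(1)[OF s, of 1] by simp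
  show "walk (side S s) (base (up_of (xs ! i))) (walk_of (xs ! i)) (base (down_of (xs ! i)))"
    "gcd (eff (up_of (xs ! i))) (eff (down_of (xs ! i))) dvd
      A_of (xs ! i) + eff (walk_of (xs ! i)) - B_of (xs ! i)"
    using vi by simp_all
  fix j u t
  assume j: "j \<in> jumps s" and lt: "i < j \<or> i = j \<and> u < t"
    and u: "u \<le> length (walk_of (xs ! i))" and t: "t \<le> length (walk_of (xs ! j))"
    and meet: "vertex (base (up_of (xs ! i))) (walk_of (xs ! i)) u
      = vertex (base (up_of (xs ! j))) (walk_of (xs ! j)) t"
  note vj = jump_valid[OF j]
  let ?w = "take u (walk_of (xs ! i)) @ drop t (walk_of (xs ! j))"
  let ?x = "Jump s (src (xs ! i)) (up_of (xs ! i)) (A_of (xs ! i)) ?w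
    (B_of (xs ! j)) (down_of (xs ! j)) (tgt (xs ! j))"
  have "walk (side S s) (base (up_of (xs ! i))) ?w (base (down_of (xs ! j)))"
    using walk_take[of "side S s" "base (up_of (xs ! i))" "walk_of (xs ! i)" "base (down_of (xs ! i))" u]
      walk_drop[of "side S s" "base (up_of (xs ! j))" "walk_of (xs ! j)" "base (down_of (xs ! j))" t]
      vi vj u t meet by (auto simp: walk_append)
  then have valid: "valid ?x" if "gcd (eff (up_of (xs ! i))) (eff (down_of (xs ! j))) dvd
      A_of (xs ! i) + eff (take u (walk_of (xs ! i))) + eff (drop t (walk_of (xs ! j))) - B_of (xs ! j)"
    using that vi vj by (simp add: add.assoc)
  have len: "i < length xs" "j < length xs" using i j by (auto simp: jumps_def)
  show "\<not> gcd (eff (up_of (xs ! i))) (eff (down_of (xs ! j))) dvd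
      A_of (xs ! i) + eff (take u (walk_of (xs ! i))) + eff (drop t (walk_of (xs ! j))) - B_of (xs ! j)"
  proof
    assume "gcd (eff (up_of (xs ! i))) (eff (down_of (xs ! j))) dvd
      A_of (xs ! i) + eff (take u (walk_of (xs ! i))) + eff (drop t (walk_of (xs ! j))) - B_of (xs ! j)"
    then have v: "valid ?x" by (rule valid)
    show False
    proof (cases "i < j")
      case True
      from minimal_no_shortcut[OF True len(2) v] show False
        using u t jump_weight[OF i] jump_weight[OF j] by simp
    next
      case False
      with lt have "i = j" "u < t" by auto
      with minimal_no_lighter[OF len(1) v] show False
        using u t jump_weight[OF i] by simp
    qed
  qed
qed

lemma minimal_jumps_cost:
  assumes s: "s \<in> {1, -1}"
  shows "(\<Sum>i\<in>jumps s. cost (xs ! i)) \<le> 20 * real n ^ 2"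
proof -
  interpret unspliceable "states S" "side S s" "jumps s" "\<lambda>i. up_of (xs ! i)" "\<lambda>i. down_of (xs ! i)"
    "\<lambda>i. walk_of (xs ! i)" "\<lambda>i. A_of (xs ! i)" "\<lambda>i. B_of (xs ! i)"
    by (rule unspliceable_jumps[OF s])
  have "(\<Sum>i\<in>jumps s. cost (xs ! i))
      = (\<Sum>i\<in>jumps s. jump_cost n (up_of (xs ! i)) (length (walk_of (xs ! i))) (down_of (xs ! i)))"
  proof (rule sum.cong[OF refl])
    fix i assume "i \<in> jumps s"
    then show "cost (xs ! i) = jump_cost n (up_of (xs ! i)) (length (walk_of (xs ! i))) (down_of (xs ! i))"
      by (cases "xs ! i") (auto simp: jumps_def)
  qed
  also have "\<dots> \<le> 20 * real n ^ 2"
    unfolding n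
    by (rule sum_jump_cost_le_side[where F = "F s 1" and G = "F s (-1)"])
       (use packing[OF s] jump_valid in auto)
  finally show ?thesis .
qed

lemma minimal_cost:
  "(\<Sum>x\<leftarrow>xs. cost x) \<le> real n * real_of_int (L 1 + L (-1) + 2 * int n + 3) + 40 * real n ^ 2"
proof -
  let ?steps = "{i. i < length xs \<and> \<not> is_Jump (xs ! i)}"
  have "{..<length xs} = ?steps \<union> (jumps 1 \<union> jumps (-1))"
  proof -
    have "sgn_of (xs ! i) \<in> {1, -1}" if "i < length xs" "is_Jump (xs ! i)" for i
      using minimal_valid[OF that(1)] that(2) by (cases "xs ! i") auto
    then show ?thesis by (auto simp: jumps_def)
  qed
  then have "(\<Sum>i<length xs. cost (xs ! i)) = (\<Sum>i\<in>?steps \<union> (jumps 1 \<union> jumps (-1)). cost (xs ! i))"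
    by simp
  also have "\<dots> = (\<Sum>i\<in>?steps. cost (xs ! i)) + (\<Sum>i\<in>jumps 1 \<union> jumps (-1). cost (xs ! i))"
    by (rule sum.union_disjoint) (auto simp: jumps_def)
  also have "(\<Sum>i\<in>jumps 1 \<union> jumps (-1). cost (xs ! i))
      = (\<Sum>i\<in>jumps 1. cost (xs ! i)) + (\<Sum>i\<in>jumps (-1). cost (xs ! i))"
    by (rule sum.union_disjoint) (auto simp: jumps_def)
  also have "(\<Sum>i\<in>?steps. cost (xs ! i)) = (\<Sum>i\<in>?steps. 1)"
  proof (rule sum.cong[OF refl])
    fix i assume "i \<in> ?steps"
    then show "cost (xs ! i) = 1" by (cases "xs ! i") auto
  qed
  also have "\<dots> = real (card ?steps)"
    by simp
  also have "card ?steps \<le> card {..<length xs}"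
    by (intro card_mono) auto
  finally have "(\<Sum>i<length xs. cost (xs ! i)) \<le> real (length xs)
      + ((\<Sum>i\<in>jumps 1. cost (xs ! i)) + (\<Sum>i\<in>jumps (-1). cost (xs ! i)))"
    by simp
  then show ?thesis
    using minimal_jumps_cost[of 1] minimal_jumps_cost[of "-1"] minimal_length
    by (simp add: sum_list_sum_nth atLeast0LessThan)
qed

end

section \<open>Extracting a plan from an arbitrary run\<close>

subsection \<open>Plans from runs\<close>

lemma step_facts:
  assumes "step S \<gamma> \<delta>"
  shows "fst \<gamma> \<in> states S" "fst \<delta> \<in> states S" "\<bar>snd \<delta> - snd \<gamma>\<bar> \<le> 1"
proof -
  obtain p d q where t: "fireable S \<gamma> (p, d, q)" "\<delta> = fire \<gamma> (p, d, q)"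
    using assms unfolding step_def by (metis prod_cases3)
  then have "(p, d, q) \<in> trans_set S" by (auto simp: fireable_def trans_set_def)
  then have "p \<in> states S \<and> q \<in> states S \<and> d \<in> {-1, 0, 1}"
    using wf unfolding wf_zocs_def by blast
  with t show "fst \<gamma> \<in> states S" "fst \<delta> \<in> states S" "\<bar>snd \<delta> - snd \<gamma>\<bar> \<le> 1"
    by (auto simp: fireable_def fire_def)
qed

lemma step_side:
  assumes "step S \<gamma> \<delta>" "s \<in> {1, -1}" "s * snd \<gamma> > 0"
  shows "(fst \<gamma>, s * snd \<delta> - s * snd \<gamma>, fst \<delta>) \<in> side S s"
proof -
  obtain p d q where t: "fireable S \<gamma> (p, d, q)" "\<delta> = fire \<gamma> (p, d, q)"
    using assms(1) unfolding step_def by (metis prod_cases3)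
  then show ?thesis
    using assms(2,3) by (auto simp: fireable_def fire_def side_def)
qed

definition segment :: "int \<Rightarrow> (nat \<Rightarrow> 'q config) \<Rightarrow> nat \<Rightarrow> nat \<Rightarrow> 'q edge list" where
  "segment s \<gamma> i j =
     map (\<lambda>k. (fst (\<gamma> k), s * snd (\<gamma> (Suc k)) - s * snd (\<gamma> k), fst (\<gamma> (Suc k)))) [i..<j]"

lemma walk_segment:
  assumes "s \<in> {1, -1}" "i \<le> j"
    and "\<And>k. i \<le> k \<Longrightarrow> k < j \<Longrightarrow> step S (\<gamma> k) (\<gamma> (Suc k)) \<and> s * snd (\<gamma> k) > 0"
  shows "walk (side S s) (fst (\<gamma> i)) (segment s \<gamma> i j) (fst (\<gamma> j)) \<and>
    eff (segment s \<gamma> i j) = s * snd (\<gamma> j) - s * snd (\<gamma> i)"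
  using assms(2,3)
proof (induction j rule: dec_induct)
  case base
  then show ?case by (simp add: segment_def)
next
  case (step j)
  have "segment s \<gamma> i (Suc j) = segment s \<gamma> i j @
      [(fst (\<gamma> j), s * snd (\<gamma> (Suc j)) - s * snd (\<gamma> j), fst (\<gamma> (Suc j)))]"
    using step.hyps by (simp add: segment_def)
  moreover have "(fst (\<gamma> j), s * snd (\<gamma> (Suc j)) - s * snd (\<gamma> j), fst (\<gamma> (Suc j))) \<in> side S s"
    using step.prems[of j] step.hyps assms(1) by (intro step_side) auto
  ultimately show ?case
    using step.IH step.prems by (auto simp: walk_append)
qed

text \<open>The steep segment contains the edges of some simple cycle of sign \<open>r\<close>. By
  maximality this cycle shares a vertex with a member of the fixed family, and the run visits that
  vertex.\<close>

lemma segment_meets_cycle: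
  assumes "s \<in> {1, -1}" "r \<in> {1, -1}" "i \<le> j"
    and "\<And>k. i \<le> k \<Longrightarrow> k < j \<Longrightarrow> step S (\<gamma> k) (\<gamma> (Suc k)) \<and> s * snd (\<gamma> k) > 0"
    and "r * (s * snd (\<gamma> j) - s * snd (\<gamma> i)) > int n"
  obtains c k where "c \<in> F s r" "i \<le> k" "k < j" "fst (\<gamma> k) \<in> verts c"
proof -
  have w: "walk (side S s) (fst (\<gamma> i)) (segment s \<gamma> i j) (fst (\<gamma> j))"
    and e: "eff (segment s \<gamma> i j) = s * snd (\<gamma> j) - s * snd (\<gamma> i)"
    using walk_segment[OF assms(1,3), of \<gamma>] assms(4) by auto
  have "\<bar>r\<bar> = 1" using assms(2) by auto
  then obtain c where c: "simple_cycle (side S s) c" "r * eff c > 0" "set c \<subseteq> set (segment s \<gamma> i j)"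
    using steep_walk_simple_cycle[OF graph[OF assms(1)] _ w] assms(5) unfolding n e by blast
  from maximal[OF assms(1,2) c(1,2)] obtain c' where "c' \<in> F s r" "verts c \<inter> verts c' \<noteq> {}"
    by (rule bexE)
  then obtain u where c': "c' \<in> F s r" "u \<in> verts c" "u \<in> verts c'"
    by (metis disjoint_iff)
  then have "u \<in> verts (segment s \<gamma> i j)" using c(3) by blast
  then obtain k where "i \<le> k" "k < j" "fst (\<gamma> k) = u"
    by (auto simp: segment_def)
  with c' show thesis using that[of c' k] by simp
qed

lemma cycle_split:
  assumes "s \<in> {1, -1}" "r \<in> {1, -1}" "c \<in> F s r" "u \<in> verts c"
  obtains c1 c2 where "c = c1 @ c2" "length c1 \<le> n" "length c2 \<le> n"
    "walk (side S s) (base c) c1 u" "walk (side S s) u c2 (base c)"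
proof -
  have c: "walk (side S s) (base c) c (base c)" "length c \<le> n"
    using cycle_facts[OF assms(1-3)] by (auto simp: simple_cycle_def)
  obtain e where "e \<in> set c" "fst e = u" using assms(4) by blast
  then obtain c1 c2 where split: "c = c1 @ e # c2" by (meson split_list)
  then obtain z where z: "walk (side S s) (base c) c1 z" "walk (side S s) z (e # c2) (base c)"
    using c(1) walk_append[of "side S s" "base c" c1 "e # c2" "base c"] by auto
  then have "z = u" using \<open>fst e = u\<close> by simp
  with z c(2) split show thesis
    by (intro that[of c1 "e # c2"]) auto
qed

text \<open>The run need not start at the base of \<open>c\<close>, so \<open>c\<close> is split at
  the vertex that is met: \<open>c2\<close> leads to the base, and the walk of the jump begins with
  \<open>c1\<close> back to the run. With the same detour through \<open>d\<close>, the effects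
  deviate by exactly \<open>eff c + eff d\<close>, a multiple of the gcd.\<close>

lemma jump_exists:
  assumes s: "s \<in> {1, -1}" and "i \<le> j"
    and run: "\<And>k. i \<le> k \<Longrightarrow> k < j \<Longrightarrow> step S (\<gamma> k) (\<gamma> (Suc k)) \<and> s * snd (\<gamma> k) > 0"
    and "border s (\<gamma> i)" "border s (\<gamma> j)"
    and c: "c \<in> F s 1" "fst (\<gamma> i) \<in> verts c" and d: "d \<in> F s (-1)" "fst (\<gamma> j) \<in> verts d"
  shows "\<exists>x. valid x \<and> src x = \<gamma> i \<and> tgt x = \<gamma> j"
proof -
  obtain c1 c2 where c12: "c = c1 @ c2" "length c2 \<le> n"
      "walk (side S s) (base c) c1 (fst (\<gamma> i))" "walk (side S s) (fst (\<gamma> i)) c2 (base c)"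
    by (rule cycle_split[OF s _ c]) auto
  obtain d1 d2 where d12: "d = d1 @ d2" "length d1 \<le> n"
      "walk (side S s) (base d) d1 (fst (\<gamma> j))" "walk (side S s) (fst (\<gamma> j)) d2 (base d)"
    by (rule cycle_split[OF s _ d]) auto
  let ?w = "c1 @ segment s \<gamma> i j @ d2"
  let ?A = "s * snd (\<gamma> i) + eff c2" and ?B = "s * snd (\<gamma> j) - eff d1"
  note seg = walk_segment[OF s assms(2), of \<gamma>, OF run]
  have w: "walk (side S s) (base c) ?w (base d)"
    using c12(3) d12(4) seg by (auto simp: walk_append)
  have "?A + eff ?w - ?B = eff c + eff d"
    using seg c12(1) d12(1) by simp
  then have dvd: "gcd (eff c) (eff d) dvd ?A + eff ?w - ?B"
    by simp
  have "enter s (\<gamma> i) c ?A" "leave s ?B d (\<gamma> j)"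
    using assms(4,5) c12 d12 by (auto simp: enter_def leave_def)
  with s c d w dvd have "valid (Jump s (\<gamma> i) c ?A ?w ?B d (\<gamma> j))"
    by (simp only: valid.simps)
  then show ?thesis by (metis src.simps(2) tgt.simps(2))
qed

lemma low_run_plan:
  assumes "i \<le> j" "\<And>k. i \<le> k \<Longrightarrow> k < j \<Longrightarrow> step S (\<gamma> k) (\<gamma> (Suc k))"
    and "\<And>k. i \<le> k \<Longrightarrow> k \<le> j \<Longrightarrow> low (\<gamma> k)"
  shows "\<exists>xs. plan (\<gamma> i) xs (\<gamma> j)"
  using assms
proof (induction j rule: dec_induct)
  case base
  then show ?case by (metis plan.simps(1))
next
  case (step j)
  then obtain xs where "plan (\<gamma> i) xs (\<gamma> j)" by auto
  moreover have "valid (Step (\<gamma> j) (\<gamma> (Suc j)))"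
    using step.prems step.hyps by simp
  ultimately have "plan (\<gamma> i) (xs @ [Step (\<gamma> j) (\<gamma> (Suc j))]) (\<gamma> (Suc j))"
    by (simp add: plan_append del: split_paired_Ex)
  then show ?case by blast
qed

lemma plan_trans: "\<exists>xs. plan \<alpha> xs \<beta> \<Longrightarrow> \<exists>ys. plan \<beta> ys \<gamma> \<Longrightarrow> \<exists>zs. plan \<alpha> zs \<gamma>"
  using plan_append by blast

text \<open>Induction on the length of the run: its first excursion out of the strip is bridged by a
  jump, and the rest of the run starts at the return to height \<open>L s\<close>, where the
  hypothesis on the starting height holds again.\<close>

lemma run_plan:
  assumes "\<And>k. k < m \<Longrightarrow> step S (\<gamma> k) (\<gamma> (Suc k))" "fst (\<gamma> 0) \<in> states S"
    and "\<And>s. s \<in> {1, -1} \<Longrightarrow> s * snd (\<gamma> 0) \<le> L s" "\<And>s. s \<in> {1, -1} \<Longrightarrow> s * snd (\<gamma> m) \<le> L s"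
  shows "\<exists>xs. plan (\<gamma> 0) xs (\<gamma> m)"
  using assms
proof (induction m arbitrary: \<gamma> rule: less_induct)
  case (less m \<gamma>)
  note run = less.prems(1)
  have state: "fst (\<gamma> k) \<in> states S" if "k \<le> m" for k
    using that less.prems(2) step_facts(2)[OF run] by (cases k) (simp_all add: Suc_le_eq)
  show ?case
  proof (cases "\<forall>k\<le>m. low (\<gamma> k)")
    case True
    then show ?thesis using run by (intro low_run_plan) auto
  next
    case False
    define i where "i = (LEAST k. k \<le> m \<and> \<not> low (\<gamma> k))"
    have i: "i \<le> m" "\<not> low (\<gamma> i)"
      using False LeastI_ex[of "\<lambda>k. k \<le> m \<and> \<not> low (\<gamma> k)"] by (auto simp: i_def)
    have low: "low (\<gamma> k)" if "k < i" for k
      using that i(1) not_less_Least[of k "\<lambda>k. k \<le> m \<and> \<not> low (\<gamma> k)"] by (auto simp: i_def)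
    obtain s where s: "s \<in> {1, -1}" and high: "s * snd (\<gamma> i) > L s + int n + 1"
      using i state unfolding low_def by (meson not_le)
    define h where "h k = s * snd (\<gamma> k)" for k
    have Ls: "L s > 0" using L[OF s] by linarith
    have h_step: "\<bar>h (Suc k) - h k\<bar> \<le> 1" if "k < m" for k
      using step_facts(3)[OF run[OF that]] s by (auto simp: h_def)
    have h0: "h 0 \<le> L s" and hm: "h m \<le> L s" and hi: "h i > L s + int n + 1"
      using less.prems(3,4) s high by (auto simp: h_def)
    have "\<exists>j\<ge>0. j \<le> i \<and> h j = L s \<and> (\<forall>k. j \<le> k \<and> k \<le> i \<longrightarrow> L s \<le> h k)"
    proof (rule last_at_level)
      show "h (Suc k) \<le> h k + 1" if "k < i" for k
        using h_step[of k] that i(1) by auto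
    qed (use h0 hi in auto)
    then obtain j where j: "j \<le> i" "h j = L s" "\<And>k. j \<le> k \<Longrightarrow> k \<le> i \<Longrightarrow> L s \<le> h k"
      by blast
    have "\<exists>j\<ge>i. j \<le> m \<and> h j = L s \<and> (\<forall>k. i \<le> k \<and> k \<le> j \<longrightarrow> L s \<le> h k)"
    proof (rule first_at_level[OF i(1)])
      show "h k \<le> h (Suc k) + 1" if "k < m" for k
        using h_step[of k] that by auto
    qed (use hi hm in auto)
    then obtain i' where i': "i \<le> i'" "i' \<le> m" "h i' = L s" "\<And>k. i \<le> k \<Longrightarrow> k \<le> i' \<Longrightarrow> L s \<le> h k"
      by blast
    \<comment> \<open>Negating the heights turns this into the last visit to
      \<open>L s + n + 1\<close> before the return at \<open>i'\<close>. From \<open>j'\<close> on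
      the run stays within the border heights.\<close>
    have "\<exists>j\<ge>i. j \<le> i' \<and> - h j = - (L s + int n + 1) \<and>
        (\<forall>k. j \<le> k \<and> k \<le> i' \<longrightarrow> - (L s + int n + 1) \<le> - h k)"
    proof (rule last_at_level[OF i'(1)])
      show "- h (Suc k) \<le> - h k + 1" if "k < i'" for k
        using h_step[of k] that i'(2) by auto
    qed (use hi i'(3) in auto)
    then obtain j' where j': "i \<le> j'" "j' \<le> i'" "h j' = L s + int n + 1"
      "\<And>k. j' \<le> k \<Longrightarrow> k \<le> i' \<Longrightarrow> h k \<le> L s + int n + 1"
      unfolding neg_equal_iff_equal neg_le_iff_le by blast
    have above: "L s \<le> h k" if "j \<le> k" "k \<le> i'" for k
      using that j(3)[of k] i'(4)[of k] by (cases "k \<le> i") auto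
    have up_run: "step S (\<gamma> k) (\<gamma> (Suc k)) \<and> s * snd (\<gamma> k) > 0" if "j \<le> k" "k < i'" for k
      using that above[of k] run[of k] i'(2) Ls by (auto simp: h_def)
    \<comment> \<open>From \<open>j\<close> to \<open>i\<close> the height rises by more than
      \<open>n\<close>, and from \<open>j'\<close> to \<open>i'\<close> it falls by
      \<open>n + 1\<close>, so both parts meet cycles of the families. Since \<open>e < i\<close>
      precedes the first exit from the strip and \<open>x \<ge> j'\<close> follows the last high
      position before \<open>i'\<close>, both configurations lie on the border, in the right
      order.\<close>
    obtain c e where e: "c \<in> F s 1" "j \<le> e" "e < i" "fst (\<gamma> e) \<in> verts c"
      using segment_meets_cycle[OF s, of 1 j i \<gamma>] up_run j(1,2) i'(1) hi by (auto simp: h_def)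
    obtain d x where x: "d \<in> F s (-1)" "j' \<le> x" "x < i'" "fst (\<gamma> x) \<in> verts d"
      using segment_meets_cycle[OF s, of "-1" j' i' \<gamma>] up_run j(1) j'(1,2,3) i'(3) by (auto simp: h_def)
    have "h e \<le> L s + int n + 1"
      using low[OF e(3)] s by (auto simp: low_def h_def)
    then have border_e: "border s (\<gamma> e)"
      using above[of e] e i' state[of e] by (auto simp: border_def h_def)
    have border_x: "border s (\<gamma> k)" if "x \<le> k" "k \<le> i'" for k
      using above[of k] j'(4)[of k] that e x i'(1,2) j'(1) state[of k] by (auto simp: border_def h_def)
    have "\<exists>xs. plan (\<gamma> 0) xs (\<gamma> e)"
      using low e(3) run i(1) by (intro low_run_plan) auto
    moreover have "\<exists>xs. plan (\<gamma> e) xs (\<gamma> x)"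
    proof -
      have "\<exists>y. valid y \<and> src y = \<gamma> e \<and> tgt y = \<gamma> x"
      proof (rule jump_exists[OF s _ _ border_e _ e(1,4) x(1,4)])
        show "e \<le> x" using e(3) x(2) j'(1) by simp
        show "step S (\<gamma> k) (\<gamma> (Suc k)) \<and> s * snd (\<gamma> k) > 0" if "e \<le> k" "k < x" for k
          using up_run[of k] that e(2) x(3) by simp
        show "border s (\<gamma> x)" using border_x[of x] x(3) by simp
      qed
      then obtain y where "plan (\<gamma> e) [y] (\<gamma> x)" by auto
      then show ?thesis by blast
    qed
    moreover have "\<exists>xs. plan (\<gamma> x) xs (\<gamma> i')"
      using x(3) run i'(2) border_low[OF s border_x] by (intro low_run_plan) auto
    moreover have "\<exists>xs. plan (\<gamma> i') xs (\<gamma> m)"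
    proof -
      have "i' > 0" using x(3) by simp
      have "\<exists>xs. plan (\<gamma> (i' + 0)) xs (\<gamma> (i' + (m - i')))"
      proof (rule less.IH)
        show "m - i' < m" using \<open>i' > 0\<close> i'(2) by simp
        show "step S (\<gamma> (i' + k)) (\<gamma> (i' + Suc k))" if "k < m - i'" for k
          using run[of "i' + k"] that by simp
        show "fst (\<gamma> (i' + 0)) \<in> states S" using state i'(2) by simp
        \<comment> \<open>On the side \<open>s\<close> the height is exactly \<open>L s\<close>; on
          the other side it is negative, hence below the positive bound.\<close>
        show "r * snd (\<gamma> (i' + 0)) \<le> L r" if "r \<in> {1, -1}" for r
          using that s i'(3) Ls L[OF that] by (auto simp: h_def)
        show "r * snd (\<gamma> (i' + (m - i'))) \<le> L r" if "r \<in> {1, -1}" for r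
          using less.prems(4)[OF that] i'(2) by simp
      qed
      then show ?thesis using i'(2) by simp
    qed
    ultimately show ?thesis by (blast intro: plan_trans)
  qed
qed

end

section \<open>Assembling the bound\<close>

lemma is_path_run:
  assumes "is_path S \<pi> \<alpha> \<beta>"
  shows "\<exists>\<gamma>. \<gamma> 0 = \<alpha> \<and> \<gamma> (length \<pi>) = \<beta> \<and> (\<forall>k<length \<pi>. step S (\<gamma> k) (\<gamma> (Suc k)))"
  using assms
proof (induction \<pi> arbitrary: \<alpha>)
  case Nil
  then show ?case by auto
next
  case (Cons x \<pi>)
  have x: "fireable S \<alpha> (snd x)" "is_path S \<pi> (fire \<alpha> (snd x)) \<beta>"
    using Cons.prems by (cases x; simp)+
  obtain \<gamma> where \<gamma>: "\<gamma> 0 = fire \<alpha> (snd x)" "\<gamma> (length \<pi>) = \<beta>"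
      "\<forall>k<length \<pi>. step S (\<gamma> k) (\<gamma> (Suc k))"
    using Cons.IH[OF x(2)] by blast
  have "step S (case_nat \<alpha> \<gamma> k) (case_nat \<alpha> \<gamma> (Suc k))" if "k < length (x # \<pi>)" for k
  proof (cases k)
    case 0
    then show ?thesis using \<gamma>(1) x(1) by (simp add: step_def del: split_paired_Ex) blast
  next
    case (Suc k')
    then show ?thesis using that \<gamma>(3) by simp
  qed
  with \<gamma> show ?case by (intro exI[of _ "case_nat \<alpha> \<gamma>"]) simp
qed

theorem theorem3:
  fixes S :: "'q zocs" and \<alpha> \<beta> :: "'q config" and n :: nat
  assumes "wf_zocs S"
    and "card (states S) = n"
    and "fst \<alpha> \<in> states S" and "fst \<beta> \<in> states S"
    and "reachable S \<alpha> \<beta>"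
  shows "\<exists>\<pi>. is_path S \<pi> \<alpha> \<beta> \<and>
           int (length \<pi>) \<le> 56 * int n ^ 2 + int n * (\<bar>snd \<alpha>\<bar> + \<bar>snd \<beta>\<bar>)"
proof -
  have "\<forall>s\<in>{1, -1}. \<exists>G. cycle_packing (side S s) r G \<and>
      (\<forall>c. simple_cycle (side S s) c \<and> r * eff c > 0 \<longrightarrow> (\<exists>c'\<in>G. verts c \<inter> verts c' \<noteq> {}))" for r
  proof
    fix s :: int assume "s \<in> {1, -1}"
    then show "\<exists>G. cycle_packing (side S s) r G \<and>
      (\<forall>c. simple_cycle (side S s) c \<and> r * eff c > 0 \<longrightarrow> (\<exists>c'\<in>G. verts c \<inter> verts c' \<noteq> {}))"
      by (rule maximal_cycle_packing[OF graph_on_side[OF assms(1)]]) blast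
  qed
  then obtain F where F: "\<And>r s. s \<in> {1, -1} \<Longrightarrow> cycle_packing (side S s) r (F r s) \<and>
      (\<forall>c. simple_cycle (side S s) c \<and> r * eff c > 0 \<longrightarrow> (\<exists>c'\<in>F r s. verts c \<inter> verts c' \<noteq> {}))"
    by metis
  \<comment> \<open>The strip covers both endpoint values and 0, with the margin
    \<open>2 * n + 1\<close> that jumps require.\<close>
  define L where "L s = max 0 (max (s * snd \<alpha>) (s * snd \<beta>)) + 2 * int n + 1" for s
  interpret low_zone S n L "\<lambda>s r. F r s"
    using F assms(1,2) by unfold_locales (auto simp: L_def)
  obtain \<pi> where "is_path S \<pi> \<alpha> \<beta>"
    using assms(5) by (auto simp: reachable_def)
  then obtain \<gamma> where \<gamma>: "\<gamma> 0 = \<alpha>" "\<gamma> (length \<pi>) = \<beta>"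
      "\<And>k. k < length \<pi> \<Longrightarrow> step S (\<gamma> k) (\<gamma> (Suc k))"
    using is_path_run by blast
  have "\<exists>xs. plan (\<gamma> 0) xs (\<gamma> (length \<pi>))"
    using \<gamma> assms(3) by (intro run_plan) (auto simp: L_def)
  then obtain xs where xs: "minimal_plan \<alpha> xs \<beta>"
    using minimal_plan_exists \<gamma> by blast
  then have "plan \<alpha> xs \<beta>" by (simp add: minimal_plan_def)
  then obtain N where N: "reach_len S \<alpha> \<beta> N" "real N \<le> (\<Sum>x\<leftarrow>xs. cost x)"
    using plan_reach_len by blast
  have "real N \<le> real n * real_of_int (L 1 + L (-1) + 2 * int n + 3) + 40 * real n ^ 2"
    using N(2) minimal_cost[OF xs] by linarith
  also have "\<dots> = real_of_int (int n * (L 1 + L (-1) + 2 * int n + 3) + 40 * int n ^ 2)"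
    by simp
  finally have "int N \<le> int n * (L 1 + L (-1) + 2 * int n + 3) + 40 * int n ^ 2"
    by linarith
  \<comment> \<open>For the signs 1 and -1 the two maxima in \<open>L\<close> add up to at most the
    sum of the absolute counter values. The rest is \<open>6 * n + 5\<close>, well below
    \<open>16 * n\<close> as \<open>n \<ge> 1\<close>; with the 40 for the jumps on both sides this
    gives 56.\<close>
  also have "int n * (L 1 + L (-1) + 2 * int n + 3) \<le> int n * (\<bar>snd \<alpha>\<bar> + \<bar>snd \<beta>\<bar> + 16 * int n)"
  proof (rule mult_left_mono)
    have "n \<ge> 1"
      using assms(1-3) card_gt_0_iff[of "states S"] by (auto simp: wf_zocs_def)
    then show "L 1 + L (-1) + 2 * int n + 3 \<le> \<bar>snd \<alpha>\<bar> + \<bar>snd \<beta>\<bar> + 16 * int n"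
      by (simp add: L_def max_def)
  qed simp
  finally have "int N \<le> 56 * int n ^ 2 + int n * (\<bar>snd \<alpha>\<bar> + \<bar>snd \<beta>\<bar>)"
    by (simp add: algebra_simps power2_eq_square)
  then show ?thesis using N(1) by (auto simp: reach_len_def)
qed

end
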